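(* Let $m$ and $n$ be positive integers. Then, modulo $\Phi_n(q)^2$, \[ \tau_0(mn,(m-1)n,q)\equiv 2m-nm(2m-1)(1-q^n)+(-1)^nq^{n(n+1)/2}\left(m\bigl(\mathcal{A}_n(q)+\mathcal{B}_n(q)-1\bigr)-\frac{3nm(m-1)}{2}(1-q^n)\right). \]
   Context: For integers $n,k$ the $q$-binomial coefficient is ${n\brack k}={n\brack k}_q=\frac{(1-q^n)(1-q^{n-1})\cdots(1-q^{n-k+1})}{(1-q)(1-q^2)\cdots(1-q^k)}$ if $0\le k\le n$, and $0$ otherwise; ${n\brack k}_{q^2}$ denotes the same with $q$ replaced by $q^2$. The $q$-trinomial coefficient of Andrews and Baxter is \[ \tau_0(N,M,q)=\sum_{k=0}^{N}(-1)^kq^{Nk-\binom{k}{2}}{N\brack k}{2N-2k\brack N-M-k}. \] $\Phi_n(q)$ is the $n$th cyclotomic polynomial. For rational functions $A(q),B(q)$ and a polynomial $P(q)\in\mathbb{Z}[q]$, $A(q)\equiv B(q)\pmod{P(q)}$ means that $A(q)-B(q)$, written as a quotient $A_1(q)/A_2(q)$, has numerator $A_1(q)$ divisible by $P(q)$ and denominator $A_2(q)$ coprime to $P(q)$. Define, for a positive integer $n$, \[ \mathcal{A}_n(q)=\begin{cases}(-1)^r(1+q^r)q^{r(3r-1)/2}, & n=3r,\\ (-1)^rq^{r(3r+1)/2}, & n=3r+1,\\ (-1)^{r+1}q^{(r+1)(3r+2)/2}, & n=3r+2,\end{cases} \qquad \mathcal{B}_n(q)=\begin{cases}(-1)^r(1+q^{2r})q^{r(3r-5)/2},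 & n=3r,\\ (-1)^rq^{r(3r+1)/2}, & n=3r+1,\\ (-1)^{r+1}q^{(r-1)(3r+2)/2}, & n=3r+2.\end{cases} \] *)

theory Defs
  imports
    Complex_Main
    "HOL-Computational_Algebra.Computational_Algebra"
    "HOL-Number_Theory.Totient"
begin

text \<open>
  Rational functions in \<open>q\<close> are elements of \<^typ>\<open>int poly fract\<close>, the fraction field of
  \<open>\<int>[q]\<close>, which is \<open>\<rat>(q)\<close>. The indeterminate is:
\<close>

definition qvar :: "int poly fract" where
  "qvar = Fract [:0, 1:] 1"

text \<open>
  The base \<open>q\<close> is an arbitrary field element, so that the base \<open>q^2\<close> is an instance as well.
  The quotient is the intended one only if \<open>q\<close> is not a root of unity (division by zero), which
  holds for the indeterminate \<^const>\<open>qvar\<close>.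
\<close>

definition qbinomial :: "'a::field \<Rightarrow> int \<Rightarrow> int \<Rightarrow> 'a" where
  "qbinomial q n k =
     (if 0 \<le> k \<and> k \<le> n
      then (\<Prod>i=1..k. 1 - q powi (n - i + 1)) / (\<Prod>i=1..k. 1 - q powi i)
      else 0)"

definition tau0 :: "nat \<Rightarrow> int \<Rightarrow> 'a::field \<Rightarrow> 'a" where
  "tau0 N M q =
     (\<Sum>k=0..N. (-1) ^ k * q powi (int N * int k - int (k choose 2))
               * qbinomial q (int N) (int k)
               * qbinomial q (2 * int N - 2 * int k) (int N - M - int k))"

text \<open>
  All the halved exponents below are even integers before halving; some of them are negative
  (those of \<open>B_n\<close> for \<open>n = 2\<close> and \<open>n = 3\<close> are \<open>-1\<close>), hence the integer exponents.
\<close>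

definition calA :: "nat \<Rightarrow> 'a::field \<Rightarrow> 'a" where
  "calA n q =
     (let r = int (n div 3) in
      if n mod 3 = 0 then (-1) powi r * (1 + q powi r) * q powi (r * (3 * r - 1) div 2)
      else if n mod 3 = 1 then (-1) powi r * q powi (r * (3 * r + 1) div 2)
      else (-1) powi (r + 1) * q powi ((r + 1) * (3 * r + 2) div 2))"

definition calB :: "nat \<Rightarrow> 'a::field \<Rightarrow> 'a" where
  "calB n q =
     (let r = int (n div 3) in
      if n mod 3 = 0 then (-1) powi r * (1 + q powi (2 * r)) * q powi (r * (3 * r - 5) div 2)
      else if n mod 3 = 1 then (-1) powi r * q powi (r * (3 * r + 1) div 2)
      else (-1) powi (r + 1) * q powi ((r - 1) * (3 * r + 2) div 2))"

definition rf_cong :: "int poly fract \<Rightarrow> int poly fract \<Rightarrow> int poly \<Rightarrow> bool" where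
  "rf_cong A B P \<longleftrightarrow>
     (\<exists>A1 A2. A2 \<noteq> 0 \<and> A - B = Fract A1 A2 \<and> P dvd A1 \<and> coprime A2 P)"

text \<open>
  The \<open>n\<close>-th cyclotomic polynomial is the product of \<open>X - \<zeta>\<close> over the primitive \<open>n\<close>-th roots of
  unity \<open>\<zeta>\<close>, read as an integer polynomial; \<open>cyclotomic_correct\<close> below shows that
  the description is proper.
\<close>

definition cyclotomic_complex :: "nat \<Rightarrow> complex poly" where
  "cyclotomic_complex n = (\<Prod>k\<in>totatives n. [:- cis (2 * pi * real k / real n), 1:])"

definition cyclotomic :: "nat \<Rightarrow> int poly" where
  "cyclotomic n = (THE p. map_poly of_int p = cyclotomic_complex n)"

lemma monic_cyclotomic_complex: "lead_coeff (cyclotomic_complex n) = 1"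
  by (simp add: cyclotomic_complex_def lead_coeff_prod)

lemma prod_roots_unity:
  assumes "n > 0"
  shows "(\<Prod>k\<in>{0<..n}. [:- cis (2 * pi * real k / real n), 1:]) = monom 1 n - 1"
    (is "?P = ?Q")
proof -
  let ?f = "\<lambda>k. cis (2 * pi * real k / real n)"
  have deg: "degree ?P = n"
    by (subst degree_prod_sum_eq) auto
  have lc: "coeff ?P n = 1"
    using lead_coeff_prod[of "\<lambda>k. [:- ?f k, 1:]" "{0<..n}"] deg by simp
  have "poly ?P z = poly ?Q z" if "z \<in> {z. z ^ n = 1}" for z
  proof -
    obtain k where k: "k < n" "z = ?f k"
      using bij_betw_roots_unity[OF assms] \<open>z \<in> _\<close> by (force simp: bij_betw_def)
    have "\<exists>j\<in>{0<..n}. z = ?f j"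
    proof (cases "k = 0")
      case True
      then show ?thesis using k assms by (intro bexI[of _ n]) auto
    qed (use k in auto)
    then show ?thesis
      using that by (auto simp: poly_prod poly_monom)
  qed
  moreover have "card {z::complex. z ^ n = 1} = n"
    using assms by (intro card_roots_unity_eq)
  moreover have "degree ?Q \<le> n"
    by (intro degree_diff_le) (auto simp: degree_monom_le)
  ultimately show ?thesis
    using deg lc assms by (intro poly_eqI_degree_lead_coeff[of _ n _ "{z. z ^ n = 1}"]) auto
qed

lemma prod_cyclotomic_complex:
  assumes "n > 0"
  shows "(\<Prod>d | d dvd n. cyclotomic_complex d) = monom 1 n - 1"
proof -
  let ?g = "\<lambda>k. [:- cis (2 * pi * real k / real n), 1:]"
  define A where "A = (\<lambda>d. {k\<in>{0<..n}. gcd k n = d})"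
  have *: "prod ?g (A d) = cyclotomic_complex (n div d)" if d: "d dvd n" for d
  proof -
    from d assms have "d > 0" by (auto intro: dvd_pos_nat)
    have "prod ?g (A d) = (\<Prod>k\<in>totatives (n div d). ?g (k * d))"
      unfolding A_def
      by (rule prod.reindex_bij_betw[symmetric]) (rule bij_betw_totatives_gcd_eq[OF d assms])
    also have "\<dots> = cyclotomic_complex (n div d)"
      using \<open>d > 0\<close> d assms unfolding cyclotomic_complex_def
      by (intro prod.cong refl) (auto elim!: dvdE simp: field_simps)
    finally show ?thesis .
  qed
  have "monom 1 n - 1 = prod ?g {0<..n}"
    using prod_roots_unity[OF assms] by simp
  also have "{0<..n} = (\<Union>d\<in>{d. d dvd n}. A d)"
    by safe (auto simp: A_def)
  also have "prod ?g \<dots> = (\<Prod>d | d dvd n. prod ?g (A d))"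
    using assms by (intro prod.UNION_disjoint) (auto simp: A_def)
  also have "\<dots> = (\<Prod>d | d dvd n. cyclotomic_complex (n div d))"
    by (intro prod.cong refl *) auto
  also have "\<dots> = (\<Prod>d | d dvd n. cyclotomic_complex d)" using assms
    by (intro prod.reindex_bij_witness[of _ "(div) n" "(div) n"]) (auto elim: dvdE)
  finally show ?thesis ..
qed

lemma coeff_prod_Ints:
  assumes "\<And>x i. x \<in> A \<Longrightarrow> coeff (f x) i \<in> \<int>"
  shows "coeff (prod f A) i \<in> (\<int> :: complex set)"
  using assms
proof (induction A arbitrary: i rule: infinite_finite_induct)
  case (insert x A)
  then show ?case by (auto simp: coeff_mult intro!: Ints_sum Ints_mult)
qed auto

lemma coeff_Ints_cancel_monic:
  fixes g h :: "complex poly"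
  assumes g: "lead_coeff g = 1" "\<And>i. coeff g i \<in> \<int>" and gh: "\<And>i. coeff (g * h) i \<in> \<int>"
  shows "coeff h i \<in> \<int>"
proof (induction "Suc (degree h) - i" arbitrary: i rule: less_induct)
  case less
  show ?case
  proof (cases "i > degree h")
    case True
    then show ?thesis by (simp add: coeff_eq_0)
  next
    case False
    let ?d = "degree g"
    have "coeff (g * h) (i + ?d) = (\<Sum>j\<le>i + ?d. coeff g j * coeff h (i + ?d - j))"
      by (simp add: coeff_mult)
    also have "\<dots> = (\<Sum>j\<le>?d. coeff g j * coeff h (i + ?d - j))"
      by (rule sum.mono_neutral_right) (auto simp: coeff_eq_0)
    also have "\<dots> = (\<Sum>j<?d. coeff g j * coeff h (i + ?d - j)) + coeff h i"
      using g(1) by (simp flip: lessThan_Suc_atMost)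
    finally have "coeff h i =
        coeff (g * h) (i + ?d) - (\<Sum>j<?d. coeff g j * coeff h (i + ?d - j))"
      by simp
    also have "\<dots> \<in> \<int>"
      using False by (intro Ints_diff gh Ints_sum Ints_mult g(2) less) auto
    finally show ?thesis .
  qed
qed

lemma coeff_cyclotomic_complex_Ints: "coeff (cyclotomic_complex n) i \<in> \<int>"
proof (induction n arbitrary: i rule: less_induct)
  case (less n)
  show ?case
  proof (cases "n = 0")
    case True
    then show ?thesis by (simp add: cyclotomic_complex_def)
  next
    case False
    let ?g = "\<Prod>d\<in>{d. d dvd n} - {n}. cyclotomic_complex d"
    have "d < n" if "d dvd n" "d \<noteq> n" for d
      using that False by (meson dvd_imp_le le_neq_implies_less neq0_conv)
    then have g: "coeff ?g j \<in> \<int>" for j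
      by (intro coeff_prod_Ints less) auto
    have lc: "lead_coeff ?g = 1"
      by (simp add: lead_coeff_prod monic_cyclotomic_complex)
    have "?g * cyclotomic_complex n = monom 1 n - 1"
      using False prod_cyclotomic_complex[of n]
      by (simp add: prod.remove[of _ n] mult.commute)
    then have gc: "coeff (?g * cyclotomic_complex n) j \<in> \<int>" for j
      by (auto simp: coeff_1 intro!: Ints_diff)
    show ?thesis
      by (rule coeff_Ints_cancel_monic[OF lc g gc])
  qed
qed

lemma cyclotomic_correct: "map_poly of_int (cyclotomic n) = cyclotomic_complex n"
proof -
  let ?c = "cyclotomic_complex n"
  define p :: "int poly" where "p = map_poly (\<lambda>x. \<lfloor>Re x\<rfloor>) ?c"
  have "map_poly of_int p = ?c"
  proof (rule poly_eqI)
    fix i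
    show "coeff (map_poly of_int p) i = coeff ?c i"
      using coeff_cyclotomic_complex_Ints[of n i]
      by (auto simp: p_def coeff_map_poly elim!: Ints_cases)
  qed
  moreover have "p' = p" if "map_poly of_int p' = ?c" for p'
  proof (rule poly_eqI)
    fix i
    from that \<open>map_poly of_int p = ?c\<close>
    have "coeff (map_poly complex_of_int p') i = coeff (map_poly complex_of_int p) i"
      by simp
    then show "coeff p' i = coeff p i" by (simp add: coeff_map_poly)
  qed
  ultimately show ?thesis
    unfolding cyclotomic_def by (rule theI)
qed

end

theory Submission
  imports Defs
begin

text \<open>
  Write \<open>\<epsilon> = 1 - q\<^sup>n\<close>, which vanishes to first order modulo \<open>\<Phi>\<^sub>n(q)\<close>. Only the terms with \<open>0 \<le> k \<le> n\<close> of
  \<open>\<tau>\<^sub>0(mn, (m-1)n, q)\<close> survive. The two outer ones are governed by the \<open>q\<close>-analogue of Babbage's congruence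
  \<open>[mn, n] \<equiv> m - nm(m-1)\<epsilon>/2\<close> modulo \<open>\<Phi>\<^sub>n(q)\<^sup>2\<close>. For \<open>k = n - j\<close> with \<open>0 < j < n\<close> the coefficient \<open>[mn, k]\<close>
  contributes a factor \<open>m\<epsilon>\<close>, so the rest matters only modulo \<open>\<Phi>\<^sub>n(q)\<close>, where \<open>q\<^sup>n = 1\<close>;
  the term turns out to be congruent to \<open>-m\<close> times
  \<open>(-1)\<^sup>j q\<^bsup>j(j-1)/2\<^esup> (1 + q\<^bsup>-j\<^esup>) (1 - q\<^sup>n) / (1 - q\<^bsup>n-j\<^esup>) [n-j, j]\<close>. These quantities add up to
  \<open>\<A>\<^sub>n(q) + \<B>\<^sub>n(q) - 2\<close> exactly, by Euler's finite form of the pentagonal number theorem,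
  the evaluation of \<open>\<Sum>\<^sub>k (-1)\<^sup>k q\<^bsup>k(k-1)/2\<^esup> [n-k, k]\<close>. Finally \<open>(-1)\<^sup>n q\<^bsup>n(n+1)/2\<^esup> \<equiv> -1\<close>
  modulo \<open>\<Phi>\<^sub>n(q)\<close>, which lets that factor be inserted in front of \<open>\<A>\<^sub>n(q) + \<B>\<^sub>n(q) - 2\<close>.
\<close>

section \<open>Cyclotomic polynomials\<close>

text \<open>\<open>cyclotomic\<close> is specified only through its image over the complex numbers,
  so factorisations and root arguments take place there and are pulled back along this injective
  ring homomorphism.\<close>

definition intpoly_to_complex :: "int poly \<Rightarrow> complex poly" where
  "intpoly_to_complex = map_poly of_int"

lemma intpoly_to_complex_mult: "intpoly_to_complex (p * r) = intpoly_to_complex p * intpoly_to_complex r"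
  by (rule poly_eqI) (simp add: intpoly_to_complex_def coeff_map_poly coeff_mult)

lemma intpoly_to_complex_1: "intpoly_to_complex 1 = 1"
  by (rule poly_eqI) (simp add: intpoly_to_complex_def coeff_map_poly coeff_1)

lemma intpoly_to_complex_prod: "intpoly_to_complex (prod f A) = (\<Prod>x\<in>A. intpoly_to_complex (f x))"
  by (induction A rule: infinite_finite_induct)
    (simp_all add: intpoly_to_complex_mult intpoly_to_complex_1)

lemma intpoly_to_complex_diff: "intpoly_to_complex (p - r) = intpoly_to_complex p - intpoly_to_complex r"
  by (rule poly_eqI) (simp add: intpoly_to_complex_def coeff_map_poly)

lemma intpoly_to_complex_monom: "intpoly_to_complex (monom c k) = monom (of_int c) k"
  by (rule poly_eqI) (simp add: intpoly_to_complex_def coeff_map_poly)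

lemma inj_intpoly_to_complex: "inj intpoly_to_complex"
proof (rule injI, rule poly_eqI)
  fix p r i assume "intpoly_to_complex p = intpoly_to_complex r"
  then have "coeff (intpoly_to_complex p) i = coeff (intpoly_to_complex r) i" by simp
  then show "coeff p i = coeff r i" by (simp add: intpoly_to_complex_def coeff_map_poly)
qed

lemma degree_intpoly_to_complex: "degree (intpoly_to_complex p) = degree p"
  unfolding intpoly_to_complex_def by (rule degree_map_poly) auto

lemma prod_cyclotomic:
  assumes "n > 0"
  shows "(\<Prod>d | d dvd n. cyclotomic d) = monom 1 n - 1"
proof (rule injD[OF inj_intpoly_to_complex])
  show "intpoly_to_complex (\<Prod>d | d dvd n. cyclotomic d) = intpoly_to_complex (monom 1 n - 1)"
    using prod_cyclotomic_complex[OF assms] cyclotomic_correct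
    by (simp add: intpoly_to_complex_prod intpoly_to_complex_diff intpoly_to_complex_monom
      intpoly_to_complex_1) (simp add: intpoly_to_complex_def)
qed

lemma cyclotomic_dvd:
  assumes "n > 0"
  shows "cyclotomic n dvd 1 - monom 1 n"
proof -
  have "cyclotomic n dvd (\<Prod>d | d dvd n. cyclotomic d)"
    using assms by (intro dvd_prodI) auto
  then show ?thesis
    using prod_cyclotomic[OF assms] by (metis dvd_minus_iff minus_diff_eq)
qed

section \<open>Coprimality to the cyclotomic polynomial\<close>

lemma poly_cyclotomic_complex_eq_0:
  assumes "poly (cyclotomic_complex n) z = 0"
  obtains k where "k \<in> totatives n" "z = cis (2 * pi * real k / real n)"
  using assms by (auto simp: cyclotomic_complex_def poly_prod)

text \<open>A common divisor of positive degree has a complex root, which \<open>p\<close> and the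
  cyclotomic polynomial would share. Over the integers a constant divisor must be excluded as well;
  it is a unit because the cyclotomic polynomial is monic.\<close>

lemma coprime_cyclotomic:
  assumes "\<And>z. poly (cyclotomic_complex n) z = 0 \<Longrightarrow> poly (intpoly_to_complex p) z \<noteq> 0"
  shows "coprime p (cyclotomic n)"
proof (rule coprimeI)
  fix d assume d: "d dvd p" "d dvd cyclotomic n"
  then obtain r s where rs: "p = d * r" "cyclotomic n = d * s"
    by (auto elim!: dvdE)
  have cc: "cyclotomic_complex n = intpoly_to_complex d * intpoly_to_complex s"
    using rs cyclotomic_correct[of n] by (metis intpoly_to_complex_def intpoly_to_complex_mult)
  have "degree d = 0"
  proof (rule ccontr)
    assume "degree d \<noteq> 0"
    then have "\<not> constant (poly (intpoly_to_complex d))"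
      by (simp add: constant_degree degree_intpoly_to_complex)
    then obtain z where "poly (intpoly_to_complex d) z = 0"
      using fundamental_theorem_of_algebra by blast
    then show False
      using assms[of z] by (simp add: cc rs intpoly_to_complex_mult)
  qed
  then obtain c where c: "d = [:c:]" by (rule degree_eq_zeroE)
  have "lead_coeff (cyclotomic n) = 1"
  proof -
    have "lead_coeff (intpoly_to_complex (cyclotomic n)) = 1"
      using monic_cyclotomic_complex[of n] cyclotomic_correct[of n]
      by (simp add: intpoly_to_complex_def)
    then show ?thesis
      by (simp only: degree_intpoly_to_complex) (simp add: intpoly_to_complex_def coeff_map_poly)
  qed
  then have "c * lead_coeff s = 1"
    using rs c by (metis lead_coeff_mult lead_coeff_pCons(2) pCons_0_0)
  then have "c dvd 1" by (metis dvd_triv_left)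
  then show "is_unit d"
    using c by (simp add: is_unit_const_poly_iff)
qed

lemma coprime_X_cyclotomic: "coprime (monom 1 k) (cyclotomic n)"
  by (rule coprime_cyclotomic)
    (auto elim!: poly_cyclotomic_complex_eq_0 simp: intpoly_to_complex_monom poly_monom)

text \<open>Makes the halves in the congruences admissible.\<close>

lemma coprime_2_cyclotomic: "coprime 2 (cyclotomic n)"
proof (rule coprime_cyclotomic)
  fix z
  have "intpoly_to_complex 2 = 2"
    by (rule poly_eqI) (auto simp: intpoly_to_complex_def coeff_map_poly numeral_poly coeff_pCons split: nat.splits)
  then show "poly (intpoly_to_complex 2) z \<noteq> 0" by simp
qed

text \<open>The value 1 would force \<open>n dvd k * l\<close>, hence \<open>n dvd l\<close>, as
  \<open>k\<close> is coprime to \<open>n\<close>.\<close>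

lemma cis_power_ne_1:
  assumes "k \<in> totatives n" "\<not> n dvd l"
  shows "cis (2 * pi * real k / real n) ^ l \<noteq> 1"
proof
  have n: "n > 0" using assms by (cases n) auto
  assume "cis (2 * pi * real k / real n) ^ l = 1"
  then have "cis (2 * pi * real (k * l) / real n) = 1"
    by (simp add: DeMoivre field_simps)
  then have "cos (2 * pi * real (k * l) / real n) = 1"
    by (metis cis.sel(1) one_complex.sel(1))
  then obtain i :: int where "2 * pi * real (k * l) / real n = real_of_int i * 2 * pi"
    unfolding cos_one_2pi_int by blast
  then have "real (k * l) = real_of_int i * real n"
    using n by (simp add: field_simps)
  then have "int (k * l) = i * int n"
    by (metis (mono_tags) of_int_eq_iff of_int_mult of_int_of_nat_eq)
  then have "int n dvd int (k * l)" by simp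
  then have "n dvd k * l" by (simp only: int_dvd_int_iff)
  moreover have "coprime n k"
    using assms(1) by (simp add: totatives_def coprime_commute)
  ultimately show False
    using assms(2) by (simp add: coprime_dvd_mult_right_iff)
qed

lemma coprime_one_minus_monom_cyclotomic:
  assumes "\<not> n dvd k"
  shows "coprime (1 - monom 1 k) (cyclotomic n)"
  using cis_power_ne_1[OF _ assms]
  by (intro coprime_cyclotomic)
    (auto elim!: poly_cyclotomic_complex_eq_0
      simp: intpoly_to_complex_monom intpoly_to_complex_diff intpoly_to_complex_1 poly_monom)

section \<open>Gaussian binomial coefficients and pentagonal sums\<close>

text \<open>
  Unlike \<^const>\<open>qbinomial\<close>, this makes sense for negative \<open>N\<close>, where it does not vanish: modulo
  \<open>\<Phi>\<^sub>n(q)\<close> the upper index may then be reduced to any representative modulo \<open>n\<close>.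
\<close>

definition gbin :: "'a::field \<Rightarrow> int \<Rightarrow> nat \<Rightarrow> 'a" where
  "gbin q N k = (\<Prod>i<k. (1 - q powi (N - int i)) / (1 - q ^ Suc i))"

lemma gbin_0 [simp]: "gbin q N 0 = 1"
  by (simp add: gbin_def)

lemma gbin_Suc: "gbin q N (Suc k) = gbin q N k * (1 - q powi (N - int k)) / (1 - q ^ Suc k)"
  by (simp add: gbin_def)

lemma gbin_eq_0:
  assumes "0 \<le> N" "N < int k"
  shows "gbin q N k = 0"
  unfolding gbin_def using assms
  by (intro prod_zero) (auto intro!: bexI[of _ "nat N"])

lemma qbinomial_eq_gbin:
  assumes "0 \<le> N"
  shows "qbinomial q N (int k) = gbin q N k"
proof (cases "int k \<le> N")
  case True
  have bij: "bij_betw (\<lambda>i. int (Suc i)) {..<k} {1..int k}"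
    by (rule bij_betwI[where g = "\<lambda>i. nat (i - 1)"]) auto
  have "gbin q N k = (\<Prod>i<k. 1 - q powi (N - int (Suc i) + 1)) / (\<Prod>i<k. 1 - q powi (int (Suc i)))"
    by (simp only: gbin_def prod_dividef power_int_of_nat) (simp add: algebra_simps)
  also have "\<dots> = (\<Prod>i=1..int k. 1 - q powi (N - i + 1)) / (\<Prod>i=1..int k. 1 - q powi i)"
    using prod.reindex_bij_betw[OF bij, of "\<lambda>i. 1 - q powi (N - i + 1)"]
      prod.reindex_bij_betw[OF bij, of "\<lambda>i. 1 - q powi i"] by simp
  finally show ?thesis using True by (simp add: qbinomial_def)
next
  case False
  then show ?thesis using assms by (simp add: qbinomial_def gbin_eq_0)
qed

section \<open>Triangular and pentagonal exponents\<close>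

lemma choose_2_Suc: "(Suc k) choose 2 = (k choose 2) + k"
  by (simp add: numeral_2_eq_2)

lemma two_choose_2: "2 * (Suc k choose 2) = Suc k * k"
  by (induction k) (simp_all add: choose_2_Suc numeral_2_eq_2)

text \<open>The generalised pentagonal numbers. Every halved exponent of \<open>calA\<close> and
  \<open>calB\<close> is \<open>pent r\<close> plus an affine expression in \<open>r\<close>; see
  \<open>pent_divs\<close>.\<close>

definition pent :: "int \<Rightarrow> int" where "pent r = r * (3 * r - 1) div 2"

lemma pent_eqI: "2 * x = r * (3 * r - 1) \<Longrightarrow> x = pent r"
  unfolding pent_def by (metis nonzero_mult_div_cancel_left zero_neq_numeral)

lemma two_pent: "2 * pent r = r * (3 * r - 1)"
proof -
  have "even (r * (3 * r - 1))" by auto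
  then show ?thesis by (simp add: pent_def)
qed

lemma pent_add_1: "pent (r + 1) = pent r + 3 * r + 1"
  using two_pent[of r] by (intro pent_eqI[symmetric]) (simp add: algebra_simps)

lemma pent_divs:
  "r * (3 * r - 1) div 2 = pent r" "r * (3 * r + 1) div 2 = pent r + r"
  "(r + 1) * (3 * r + 2) div 2 = pent r + 3 * r + 1" "r * (3 * r - 5) div 2 = pent r - 2 * r"
  "(r - 1) * (3 * r + 2) div 2 = pent r - 1"
proof -
  have h: "y div 2 = x" if "2 * x = y" for x y :: int using that by auto
  show "r * (3 * r - 1) div 2 = pent r" "r * (3 * r + 1) div 2 = pent r + r"
    "(r + 1) * (3 * r + 2) div 2 = pent r + 3 * r + 1" "r * (3 * r - 5) div 2 = pent r - 2 * r"
    "(r - 1) * (3 * r + 2) div 2 = pent r - 1"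
    using two_pent[of r] by (auto intro!: h simp: algebra_simps)
qed

lemma minus_1_powi_of_nat: "(-1 :: 'a :: field) powi int r = (-1) ^ r" "(-1 :: 'a :: field) powi (int r + 1) = (-1) ^ Suc r"
  by (simp_all add: power_int_add)

lemma mod_3_cases:
  obtains r where "n = 3 * r" | r where "n = 3 * r + 1" | r where "n = 3 * r + (2 :: nat)"
proof -
  have "n = 3 * (n div 3) \<or> n = 3 * (n div 3) + 1 \<or> n = 3 * (n div 3) + 2" by presburger
  then show ?thesis using that by blast
qed

section \<open>Identities of Gaussian binomials when q is not a root of unity\<close>

context
  fixes q :: "'a::field"
  assumes q0: "q \<noteq> 0" and q_power_ne_1: "\<forall>k>0. q ^ k \<noteq> 1"
begin

lemma one_minus_q_power_Suc: "1 - q ^ Suc k \<noteq> 0"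
  using q_power_ne_1 by (metis eq_iff_diff_eq_0 zero_less_Suc)

text \<open>The identities below are proved after multiplication by a denominator
  \<open>1 - q ^ Suc k\<close>, which this rule then removes.\<close>

lemma one_minus_q_power_cancel:
  "x * (1 - q ^ Suc k) = y * (1 - q ^ Suc k) \<Longrightarrow> x = y"
  using one_minus_q_power_Suc[of k] mult_right_cancel by blast

lemma gbin_Suc_mult: "gbin q N (Suc k) * (1 - q ^ Suc k) = gbin q N k * (1 - q powi (N - int k))"
  using one_minus_q_power_Suc[of k] by (simp add: gbin_Suc del: power_Suc)

text \<open>Passing from k to k + 1 multiplies both sides by the same numerator, because N - (k + 1)
  = (N - 1) - k.\<close>

lemma gbin_absorb: "gbin q N (Suc k) * (1 - q ^ Suc k) = (1 - q powi N) * gbin q (N - 1) k"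
proof (induction k)
  case 0
  show ?case using gbin_Suc_mult[of N 0] by simp
next
  case (Suc k)
  have "gbin q N (Suc k) = (1 - q powi N) * gbin q (N - 1) k / (1 - q ^ Suc k)"
    using Suc one_minus_q_power_Suc[of k] by (simp add: field_simps del: power_Suc)
  moreover have "N - int (Suc k) = N - 1 - int k" by simp
  ultimately show ?case
    unfolding gbin_Suc_mult[of N "Suc k"] gbin_Suc[of q "N - 1" k] by (simp only: times_divide_eq_left times_divide_eq_right mult.assoc)
qed

lemma gbin_self: "gbin q (int k) k = 1"
proof (induction k)
  case (Suc k)
  have "int (Suc k) - 1 = int k" by simp
  then have "gbin q (int (Suc k)) (Suc k) * (1 - q ^ Suc k) = 1 - q ^ Suc k"
    using gbin_absorb[of "int (Suc k)" k] Suc by (simp only: power_int_of_nat mult_1_right)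
  then show ?case
    using one_minus_q_power_Suc[of k] by (simp only: mult_cancel_right2) simp
qed simp

lemma q_powi_shift: "q powi N = q powi (N - 1 - int k) * q ^ Suc k"
proof -
  have "N = N - 1 - int k + int (Suc k)" by simp
  then show ?thesis
    using q0 power_int_add[of q "N - 1 - int k" "int (Suc k)"] by (simp only: power_int_of_nat) simp
qed

text \<open>After multiplication by 1 - q^(k+1) all terms are multiples of
  \<open>gbin q (N - 1) k\<close>, by absorption on the left and by the last factor on the right.
  What remains is 1 - q^N = (1 - q^(N-1-k)) + q^(N-1-k) (1 - q^(k+1)).\<close>

lemma gbin_pascal:
  "gbin q N (Suc k) = gbin q (N - 1) (Suc k) + q powi (N - 1 - int k) * gbin q (N - 1) k"
proof -
  have "gbin q N (Suc k) * (1 - q ^ Suc k)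
      = (gbin q (N - 1) (Suc k) + q powi (N - 1 - int k) * gbin q (N - 1) k) * (1 - q ^ Suc k)"
    unfolding distrib_right gbin_absorb[of N] gbin_Suc_mult[of "N - 1"] q_powi_shift[of N k]
    by (simp add: algebra_simps del: power_Suc)
  then show ?thesis by (rule one_minus_q_power_cancel)
qed

text \<open>As for \<open>gbin_pascal\<close>, with the other splitting 1 - q^N = q^(k+1) (1 -
  q^(N-1-k)) + (1 - q^(k+1)).\<close>

lemma gbin_pascal':
  "gbin q N (Suc k) = q ^ Suc k * gbin q (N - 1) (Suc k) + gbin q (N - 1) k"
proof -
  have "gbin q N (Suc k) * (1 - q ^ Suc k)
      = q ^ Suc k * (gbin q (N - 1) (Suc k) * (1 - q ^ Suc k)) + gbin q (N - 1) k * (1 - q ^ Suc k)"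
    unfolding gbin_absorb[of N] gbin_Suc_mult[of "N - 1"] q_powi_shift[of N k]
    by (simp add: algebra_simps del: power_Suc)
  also have "\<dots> = (q ^ Suc k * gbin q (N - 1) (Suc k) + gbin q (N - 1) k) * (1 - q ^ Suc k)"
    by (simp only: algebra_simps)
  finally show ?thesis by (rule one_minus_q_power_cancel)
qed

text \<open>Each numerator is reflected by 1 - q^(-N-i) = - q^(-N-i) (1 - q^(N+i)). The upper index
  on the right moves with k, so the induction step needs absorption.\<close>

lemma gbin_uminus:
  "gbin q (- N) k = (-1) ^ k * q powi (- (N * int k + int (k choose 2))) * gbin q (N + int k - 1) k"
proof (induction k)
  case (Suc k)
  have 1: "gbin q (N + int k) (Suc k) * (1 - q ^ Suc k) = (1 - q powi (N + int k)) * gbin q (N + int k - 1) k"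
    by (rule gbin_absorb)
  have 2: "1 - q powi (- N - int k) = - (q powi (- N - int k)) * (1 - q powi (N + int k))"
    using q0 power_int_add[of q "- N - int k" "N + int k"] by (simp add: algebra_simps)
  have 3: "q powi (- (N * int (Suc k) + int (Suc k choose 2)))
      = q powi (- (N * int k + int (k choose 2))) * q powi (- N - int k)"
    using q0 by (simp add: choose_2_Suc algebra_simps flip: power_int_add)
  have "gbin q (- N) (Suc k) * (1 - q ^ Suc k)
      = (-1) ^ Suc k * q powi (- (N * int (Suc k) + int ((Suc k) choose 2)))
        * (gbin q (N + int k) (Suc k) * (1 - q ^ Suc k))"
    unfolding 1 gbin_Suc_mult[of "- N"] 2 3 Suc power_Suc[of "-1"] by (simp only: mult_ac mult_minus_left mult_minus_right mult_1_left)
  then have "gbin q (- N) (Suc k) = (-1) ^ Suc k * q powi (- (N * int (Suc k) + int ((Suc k) choose 2)))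
        * gbin q (N + int k) (Suc k)"
    by - (rule one_minus_q_power_cancel[of _ k], simp only: mult.assoc)
  then show ?case by (simp only: of_nat_Suc) (simp add: add.commute)
qed (simp add: binomial_eq_0)

text \<open>For N = 1 the reflected coefficient is [k, k] = 1. Since mn - 1 is -1 modulo n, this
  evaluates [mn - 1, k] modulo Phi_n(q).\<close>

lemma gbin_uminus_1: "gbin q (- 1) k = (-1) ^ k * q powi (- int (Suc k choose 2))"
  using gbin_uminus[of 1 k] by (simp add: gbin_self choose_2_Suc add.commute)

text \<open>With K = k + 1, both sides times 1 - q^K reduce to [2K - 1, K - 1], and 1 - q^(2K) = (1
  + q^K) (1 - q^K).\<close>

lemma gbin_double:
  "gbin q (2 * int (Suc k)) (Suc k) = (1 + q ^ Suc k) * gbin q (2 * int (Suc k) - 1) (Suc k)"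
proof -
  have 1: "q powi (2 * int (Suc k)) = q ^ Suc k * q ^ Suc k"
    using power_int_add[of q "int (Suc k)" "int (Suc k)"] q0
    by (simp only: mult_2 power_int_of_nat not_False_eq_True simp_thms)
  have 2: "2 * int (Suc k) - 1 - int k = int (Suc k)" by simp
  have "gbin q (2 * int (Suc k)) (Suc k) * (1 - q ^ Suc k)
      = (1 + q ^ Suc k) * (gbin q (2 * int (Suc k) - 1) (Suc k) * (1 - q ^ Suc k))"
    unfolding gbin_absorb[of "2 * int (Suc k)"] gbin_Suc_mult[of "2 * int (Suc k) - 1"] 1 2 power_int_of_nat
    by (simp only: algebra_simps mult_1_left)
  then show ?thesis
    by - (rule one_minus_q_power_cancel[of _ k], simp only: mult.assoc)
qed

text \<open>Links the coefficient [2j, j] in the middle terms of the trinomial sum with [n - j, j],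
  congruent to [-j, j], in the pentagonal sum. Reflection yields [2j - 1, j], which
  \<open>gbin_double\<close> turns into [2j, j]. At j = 0 the left side would be twice the
  right.\<close>

lemma gbin_central_reflect:
  assumes "j > 0"
  shows "(1 + q powi (- int j)) * gbin q (- int j) j
    = (-1) ^ j * q powi (- (int j * int j + int (j choose 2) + int j)) * gbin q (2 * int j) j"
proof -
  obtain k where j: "j = Suc k" using assms by (cases j) auto
  have "q powi (- int j) * q ^ j = 1"
    using q0 by (simp add: power_int_minus)
  then have 1: "1 + q powi (- int j) = q powi (- int j) * (1 + q ^ j)"
    by (simp add: algebra_simps)
  have 2: "q powi (- (int j * int j + int (j choose 2) + int j))
      = q powi (- (int j * int j + int (j choose 2))) * q powi (- int j)"
    using q0 by (simp flip: power_int_add)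
  show ?thesis
    unfolding 1 2 gbin_uminus[of "int j" j] gbin_double[of k, folded j]
    by (simp only: mult_2 mult_2_right mult_ac)
qed

section \<open>Finite pentagonal number theorem\<close>

text \<open>Truncated subtraction is harmless here: for \<open>k > n\<close> the coefficient vanishes, as it should.\<close>

definition diag :: "nat \<Rightarrow> nat \<Rightarrow> 'a" where
  "diag n k = gbin q (int (n - k)) k"

text \<open>Without signs and at q = 1 these are Fibonacci numbers. The sum of interest has a = 0;
  the case a = -1 enters only through coupled recurrences.\<close>

definition fibsum :: "int \<Rightarrow> nat \<Rightarrow> 'a" where
  "fibsum a n = (\<Sum>k\<le>n. (-1) ^ k * q powi (int (k choose 2) + a * int k) * diag n k)"

lemma diag_0 [simp]: "diag n 0 = 1"
  by (simp add: diag_def)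

lemma diag_eq_0: "n < 2 * k \<Longrightarrow> diag n k = 0"
  unfolding diag_def by (rule gbin_eq_0) auto

lemma diag_pascal: "diag (n + 2) (Suc k) = diag (n + 1) (Suc k) + q powi (int n - 2 * int k) * diag n k"
proof (cases "k \<le> n")
  case True
  then obtain d where n: "n = k + d" using le_Suc_ex by blast
  have e: "int n - 2 * int k = 1 + int d - 1 - int k" by (simp add: n)
  have "diag (n + 2) (Suc k) = gbin q (1 + int d) (Suc k)"
    "diag (n + 1) (Suc k) = gbin q (1 + int d - 1) (Suc k)" "diag n k = gbin q (1 + int d - 1) k"
    by (simp_all add: diag_def n)
  then show ?thesis
    unfolding e using gbin_pascal[of "1 + int d" k] by simp
qed (simp add: diag_eq_0)

lemma diag_pascal': "diag (n + 2) (Suc k) = q ^ Suc k * diag (n + 1) (Suc k) + diag n k"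
proof (cases "k \<le> n")
  case True
  then obtain d where n: "n = k + d" using le_Suc_ex by blast
  have "diag (n + 2) (Suc k) = gbin q (1 + int d) (Suc k)"
    "diag (n + 1) (Suc k) = gbin q (1 + int d - 1) (Suc k)" "diag n k = gbin q (1 + int d - 1) k"
    by (simp_all add: diag_def n)
  then show ?thesis
    using gbin_pascal'[of "1 + int d" k] by (simp only:)
qed (simp add: diag_eq_0)

text \<open>Supplies a common range, so that sums with different \<open>n\<close> can be compared
  term by term.\<close>

lemma fibsum_extend:
  assumes "n \<le> K"
  shows "fibsum a n = (\<Sum>k\<le>K. (-1) ^ k * q powi (int (k choose 2) + a * int k) * diag n k)"
  unfolding fibsum_def using assms
  by (intro sum.mono_neutral_left) (auto simp: diag_eq_0)

lemma fibsum_split: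
  assumes "n \<le> Suc K"
  shows "fibsum a n = 1 + (\<Sum>k\<le>K. (-1) ^ Suc k * q powi (int (Suc k choose 2) + a * int (Suc k)) * diag n (Suc k))"
  unfolding fibsum_extend[OF assms] by (subst sum.atMost_Suc_shift) (simp add: binomial_eq_0)

text \<open>The first Pascal rule, applied termwise. Its factor q^(n-2k) combines with the weight of
  index k + 1 to q^n times the weight of index k for a = -1.\<close>

lemma fibsum_0_rec: "fibsum 0 (n + 2) = fibsum 0 (n + 1) - q ^ n * fibsum (-1) n"
proof -
  have "fibsum 0 (n + 2) - fibsum 0 (n + 1)
      = (\<Sum>k\<le>n+1. (-1) ^ Suc k * q powi (int (Suc k choose 2)) * (diag (n + 2) (Suc k) - diag (n + 1) (Suc k)))"
    using fibsum_split[of "n + 2" "n + 1" 0] fibsum_split[of "n + 1" "n + 1" 0]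
    unfolding right_diff_distrib sum_subtractf
    by (simp only: mult_zero_left add_0_right) simp
  also have "\<dots> = (\<Sum>k\<le>n+1. (-1) ^ Suc k * q powi (int (Suc k choose 2)) * (q powi (int n - 2 * int k) * diag n k))"
    by (simp only: diag_pascal add_diff_cancel_left')
  also have "\<dots> = (\<Sum>k\<le>n+1. - (q ^ n * ((-1) ^ k * q powi (int (k choose 2) + (-1) * int k) * diag n k)))"
  proof (rule sum.cong)
    fix k
    have e: "q powi (int (Suc k choose 2)) * q powi (int n - 2 * int k)
        = q ^ n * q powi (int (k choose 2) + (-1) * int k)"
      using q0 by (simp add: choose_2_Suc algebra_simps flip: power_int_add power_int_of_nat)
    have "(-1) ^ Suc k * q powi (int (Suc k choose 2)) * (q powi (int n - 2 * int k) * diag n k)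
        = - ((-1) ^ k * (q powi (int (Suc k choose 2)) * q powi (int n - 2 * int k)) * diag n k)"
      by (simp only: power_Suc mult_minus_left mult_1_left mult.assoc)
    also have "\<dots> = - (q ^ n * ((-1) ^ k * q powi (int (k choose 2) + (-1) * int k) * diag n k))"
      unfolding e by (simp only: mult_ac)
    finally show "(-1) ^ Suc k * q powi (int (Suc k choose 2)) * (q powi (int n - 2 * int k) * diag n k)
      = - (q ^ n * ((-1) ^ k * q powi (int (k choose 2) + (-1) * int k) * diag n k))" .
  qed simp
  also have "\<dots> = - (q ^ n * fibsum (-1) n)"
    unfolding fibsum_extend[of n "n + 1" "-1", OF le_add1] by (simp only: sum_negf sum_distrib_left)
  finally show ?thesis by (simp add: algebra_simps)
qed

text \<open>The second Pascal rule, applied termwise. Its factor q^(k+1) cancels the weight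
  q^(-(k+1)), so both sums on the right have a = 0.\<close>

lemma fibsum_minus_1_rec: "fibsum (-1) (n + 2) = fibsum 0 (n + 1) - fibsum 0 n / q"
proof -
  have 1: "(-1) ^ Suc k * q powi (int (Suc k choose 2) + (-1) * int (Suc k)) * diag (n + 2) (Suc k)
     = (-1) ^ Suc k * q powi (int (Suc k choose 2) + 0 * int (Suc k)) * diag (n + 1) (Suc k)
       - (-1) ^ k * q powi (int (k choose 2) + 0 * int k) * diag n k / q" for k
  proof -
    have a: "q powi (int (Suc k choose 2) + (-1) * int (Suc k)) * q ^ Suc k = q powi (int (Suc k choose 2))"
      using q0 by (simp flip: power_int_add power_int_of_nat del: power_Suc)
    have b: "q powi (int (Suc k choose 2) + (-1) * int (Suc k)) = q powi (int (k choose 2)) / q"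
      using q0 by (simp add: choose_2_Suc power_int_diff flip: power_int_add)
    have "(-1) ^ Suc k * q powi (int (Suc k choose 2) + (-1) * int (Suc k)) * diag (n + 2) (Suc k)
      = (-1) ^ Suc k * (q powi (int (Suc k choose 2) + (-1) * int (Suc k)) * q ^ Suc k) * diag (n + 1) (Suc k)
        - (-1) ^ k * q powi (int (Suc k choose 2) + (-1) * int (Suc k)) * diag n k"
      unfolding diag_pascal' power_Suc[of "-1"] by (simp add: algebra_simps del: power_Suc of_nat_Suc)
    then show ?thesis unfolding a unfolding b by (simp del: power_Suc)
  qed
  have "fibsum (-1) (n + 2) = fibsum 0 (n + 1)
     - (\<Sum>k\<le>n+1. (-1) ^ k * q powi (int (k choose 2) + 0 * int k) * diag n k) / q"
    using fibsum_split[of "n + 2" "n + 1" "-1"] fibsum_split[of "n + 1" "n + 1" 0]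
    unfolding 1 sum_subtractf sum_divide_distrib by (simp del: power_Suc sum.atMost_Suc)
  then show ?thesis
    unfolding fibsum_extend[of n "n + 1" 0, OF le_add1] .
qed

lemma fibsum_0_rec4:
  "fibsum 0 (n + 4) = fibsum 0 (n + 3) - q ^ (n + 2) * fibsum 0 (n + 1) + q ^ (n + 1) * fibsum 0 n"
proof -
  have "n + 2 + 2 = n + 4" "n + 2 + 1 = n + 3" by simp_all
  then have "fibsum 0 (n + 4) = fibsum 0 (n + 3) - q ^ (n + 2) * (fibsum 0 (n + 1) - fibsum 0 n / q)"
    using fibsum_0_rec[of "n + 2"] fibsum_minus_1_rec[of n] by metis
  then show ?thesis
    using q0 by (simp add: right_diff_distrib power_add power2_eq_square)
qed

lemma fibsum_0_base: "fibsum 0 0 = 1" "fibsum 0 1 = 1" "fibsum 0 2 = 0" "fibsum 0 3 = - q"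
proof -
  have m: "fibsum (-1) 0 = 1" "fibsum (-1) 1 = 1"
    by (simp_all add: fibsum_def binomial_eq_0 diag_eq_0)
  show 01: "fibsum 0 0 = 1" "fibsum 0 1 = 1"
    by (simp_all add: fibsum_def binomial_eq_0 diag_eq_0)
  show 2: "fibsum 0 2 = 0"
    using fibsum_0_rec[of 0] m 01 by (simp add: numeral_2_eq_2)
  show "fibsum 0 3 = - q"
    using fibsum_0_rec[of 1] m 2 by (simp add: numeral_3_eq_3 numeral_2_eq_2)
qed

text \<open>The recurrence \<open>fibsum_0_rec4\<close> has order four, so the induction carries
  four consecutive values. A step moves by three indices: the last value becomes the first, and
  three new ones are computed.\<close>

lemma fibsum_0_closed:
  "fibsum 0 (3 * r) = (-1) ^ r * q powi pent (int r)
   \<and> fibsum 0 (3 * r + 1) = (-1) ^ r * q powi (pent (int r) + int r)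
   \<and> fibsum 0 (3 * r + 2) = 0
   \<and> fibsum 0 (3 * r + 3) = (-1) ^ Suc r * q powi pent (int r + 1)"
proof (induction r)
  case 0
  show ?case using fibsum_0_base by (simp add: pent_def numeral_2_eq_2)
next
  case (Suc r)
  define e where "e = pent (int r)"
  have pe: "pent (int r + 1) = e + 3 * int r + 1" "pent (int r + 1 + 1) = e + 6 * int r + 5"
    unfolding pent_add_1 e_def by simp_all
  have "q powi (numeral w * int k) = (q ^ k) ^ numeral w" for k w
    using power_int_of_nat[of q "k * numeral w"] by (simp add: power_mult mult.commute)
  \<comment> \<open>All powers are broken into \<open>q powi e\<close>, \<open>q ^ r\<close> and
    powers of \<open>q\<close>, so that the recurrence becomes a polynomial identity.\<close>
  then have p: "q powi (a + int k) = q powi a * q ^ k" "q powi (a + 1) = q powi a * q"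
    "q powi (a + numeral w * int k) = q powi a * (q ^ k) ^ numeral w"
    "q powi (a + numeral w) = q powi a * q ^ numeral w" for a k w
    using q0 by (simp_all add: power_int_add)
  have IH: "fibsum 0 (3 * r) = (-1) ^ r * q powi e"
    "fibsum 0 (3 * r + 1) = (-1) ^ r * (q powi e * q ^ r)"
    "fibsum 0 (3 * r + 2) = 0"
    "fibsum 0 (3 * r + 3) = (-1) ^ Suc r * (q powi e * (q ^ r) ^ 3 * q)"
    using Suc unfolding pe e_def[symmetric] p by simp_all
  have pw: "q ^ (3 * r) = (q ^ r) ^ 3"
    by (simp add: mult.commute flip: power_mult)
  have 4: "fibsum 0 (3 * r + 4) = (-1) ^ Suc r * (q powi e * (q ^ r) ^ 4 * q ^ 2)"
    using fibsum_0_rec4[of "3 * r"] unfolding IH power_add pw by (simp add: eval_nat_numeral algebra_simps)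
  have "fibsum 0 (3 * r + 1 + 4) = fibsum 0 (3 * r + 1 + 3) - q ^ (3 * r + 1 + 2) * fibsum 0 (3 * r + 1 + 1)
      + q ^ (3 * r + 1 + 1) * fibsum 0 (3 * r + 1)"
    by (rule fibsum_0_rec4)
  moreover have "3 * r + 1 + 3 = 3 * r + 4" "3 * r + 1 + 1 = 3 * r + 2" "3 * r + 1 + 4 = 3 * r + 5" by simp_all
  ultimately have 5: "fibsum 0 (3 * r + 5) = 0"
    by (simp only: 4 IH power_add pw) (simp add: eval_nat_numeral algebra_simps)
  have "fibsum 0 (3 * r + 2 + 4) = fibsum 0 (3 * r + 2 + 3) - q ^ (3 * r + 2 + 2) * fibsum 0 (3 * r + 2 + 1)
      + q ^ (3 * r + 2 + 1) * fibsum 0 (3 * r + 2)"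
    by (rule fibsum_0_rec4)
  moreover have "3 * r + 2 + 3 = 3 * r + 5" "3 * r + 2 + 1 = 3 * r + 3" "3 * r + 2 + 4 = 3 * r + 6" by simp_all
  ultimately have 6: "fibsum 0 (3 * r + 6) = (-1) ^ r * (q powi e * (q ^ r) ^ 6 * q ^ 5)"
    by (simp only: 5 IH power_add pw) (simp add: eval_nat_numeral algebra_simps)
  have ix: "3 * Suc r = 3 * r + 3" "3 * r + 3 + 1 = 3 * r + 4" "3 * r + 3 + 2 = 3 * r + 5"
    "3 * r + 3 + 3 = 3 * r + 6" "int (Suc r) = int r + 1" by simp_all
  have exps: "q powi (e + 3 * int r + 1) = q powi e * (q ^ r) ^ 3 * q"
    "q powi (e + 3 * int r + 1 + (int r + 1)) = q powi e * (q ^ r) ^ 4 * q ^ 2"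
    "q powi (e + 6 * int r + 5) = q powi e * (q ^ r) ^ 6 * q ^ 5"
    unfolding p add.assoc[symmetric] by (simp_all add: eval_nat_numeral algebra_simps)
  show ?case
    unfolding ix pe exps IH 4 5 6 by simp
qed

section \<open>A_n and B_n as pentagonal sums\<close>

text \<open>\<open>fibsum 0\<close> vanishes exactly at indices 2 modulo 3. Hence both terms survive
  only when 3 divides n + 2, which is where \<open>calA\<close> has two summands.\<close>

lemma calA_eq_fibsum: "calA (n + 2) q = fibsum 0 (n + 2) - q ^ (n + 1) * fibsum 0 n"
proof (cases n rule: mod_3_cases)
  case (1 r)
  have d: "(n + 2) div 3 = r" "(n + 2) mod 3 = 2" using 1 by presburger+
  have c: "fibsum 0 (n + 2) = 0" "fibsum 0 n = (-1) ^ r * q powi pent (int r)"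
    using fibsum_0_closed[of r] 1 by simp_all
  have e: "q powi (pent (int r) + 3 * int r + 1) = q ^ (n + 1) * q powi pent (int r)"
    using q0 1 by (simp add: algebra_simps flip: power_int_add power_int_of_nat)
  show ?thesis
    unfolding calA_def Let_def d c pent_divs e minus_1_powi_of_nat by simp
next
  case (2 r)
  have d: "(n + 2) div 3 = Suc r" "(n + 2) mod 3 = 0" using 2 by presburger+
  have "n + 2 = 3 * r + 3" "int (Suc r) = int r + 1" using 2 by simp_all
  then have c: "fibsum 0 (n + 2) = (-1) ^ Suc r * q powi pent (int (Suc r))"
    "fibsum 0 n = (-1) ^ r * q powi (pent (int r) + int r)"
    using fibsum_0_closed[of r] 2 by (simp_all only:)
  have e: "q powi int (Suc r) * q powi pent (int (Suc r)) = q ^ (n + 1) * q powi (pent (int r) + int r)"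
    using q0 2 pent_add_1[of "int r"]
    by (simp add: algebra_simps flip: power_int_add power_int_of_nat)
  show ?thesis
    unfolding calA_def Let_def d c pent_divs minus_1_powi_of_nat
    using e[symmetric] by (simp add: algebra_simps del: of_nat_Suc)
next
  case (3 r)
  have d: "(n + 2) div 3 = Suc r" "(n + 2) mod 3 = 1" using 3 by presburger+
  have "n + 2 = 3 * Suc r + 1" using 3 by simp
  then have c: "fibsum 0 (n + 2) = (-1) ^ Suc r * q powi (pent (int (Suc r)) + int (Suc r))"
    using fibsum_0_closed[of "Suc r"] by (simp only:)
  have c': "fibsum 0 n = 0"
    using fibsum_0_closed[of r] 3 by (simp only:)
  show ?thesis
    unfolding calA_def Let_def d c c' pent_divs minus_1_powi_of_nat by simp
qed

lemma calB_eq_fibsum: "calB (n + 2) q = fibsum 0 (n + 2) - fibsum 0 n / q"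
proof (cases n rule: mod_3_cases)
  case (1 r)
  have d: "(n + 2) div 3 = r" "(n + 2) mod 3 = 2" using 1 by presburger+
  have c: "fibsum 0 (n + 2) = 0" "fibsum 0 n = (-1) ^ r * q powi pent (int r)"
    using fibsum_0_closed[of r] 1 by simp_all
  have e: "q powi (pent (int r) - 1) = q powi pent (int r) / q"
    using q0 by (simp add: power_int_diff)
  show ?thesis
    unfolding calB_def Let_def d c pent_divs e minus_1_powi_of_nat by simp
next
  case (2 r)
  have d: "(n + 2) div 3 = Suc r" "(n + 2) mod 3 = 0" using 2 by presburger+
  have "n + 2 = 3 * r + 3" "int (Suc r) = int r + 1" using 2 by simp_all
  then have c: "fibsum 0 (n + 2) = (-1) ^ Suc r * q powi pent (int (Suc r))"
    "fibsum 0 n = (-1) ^ r * q powi (pent (int r) + int r)"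
    using fibsum_0_closed[of r] 2 by (simp_all only:)
  have e1: "q powi (pent (int (Suc r)) - 2 * int (Suc r)) = q powi (pent (int r) + int r) / q"
    using q0 pent_add_1[of "int r"]
    by (simp add: algebra_simps power_int_diff power_int_add)
  have e2: "q powi (2 * int (Suc r)) * q powi (pent (int (Suc r)) - 2 * int (Suc r)) = q powi pent (int (Suc r))"
    using q0 by (simp flip: power_int_add del: of_nat_Suc)
  show ?thesis
    unfolding calB_def Let_def d c pent_divs minus_1_powi_of_nat e2[symmetric]
    unfolding e1 by (simp add: algebra_simps del: of_nat_Suc)
next
  case (3 r)
  have d: "(n + 2) div 3 = Suc r" "(n + 2) mod 3 = 1" using 3 by presburger+
  have "n + 2 = 3 * Suc r + 1" using 3 by simp
  then have c: "fibsum 0 (n + 2) = (-1) ^ Suc r * q powi (pent (int (Suc r)) + int (Suc r))"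
    using fibsum_0_closed[of "Suc r"] by (simp only:)
  have c': "fibsum 0 n = 0"
    using fibsum_0_closed[of r] 3 by (simp only:)
  show ?thesis
    unfolding calB_def Let_def d c c' pent_divs minus_1_powi_of_nat by simp
qed

lemma calA_plus_calB:
  assumes "n > 0"
  shows "calA n q + calB n q - 2 = (\<Sum>j\<in>{1..<n}. (-1) ^ j * q powi int (j choose 2)
    * (1 + q powi (- int j)) * (1 - q ^ n) / (1 - q ^ (n - j)) * gbin q (int (n - j)) j)"
    (is "_ = sum (?f n) _")
proof (cases "n = 1")
  case True
  then show ?thesis by (simp add: calA_def calB_def)
next
  case False
  then obtain n' where n: "n = n' + 2"
    using assms by (intro that[of "n - 2"]) simp
  have f: "?f n (Suc k) = 2 * ((-1) ^ Suc k * q powi (int (Suc k choose 2) + 0 * int (Suc k)) * diag n (Suc k))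
      - (q ^ (n' + 1) + 1 / q) * ((-1) ^ k * q powi (int (k choose 2) + 0 * int k) * diag n' k)"
    if kn: "k \<le> n'" for k
  proof -
    obtain d where d: "n' = k + d" using kn le_Suc_ex by blast
    define X where "X = gbin q (1 + int d) (Suc k)"
    define Y where "Y = gbin q (int d) k"
    have XY: "X * (1 - q ^ Suc k) = (1 - q ^ Suc d) * Y"
      using gbin_absorb[of "1 + int d" k] unfolding X_def Y_def
      by (simp add: power_int_add q0 del: power_Suc) simp
    have dg: "diag n (Suc k) = X" "diag n' k = Y" "gbin q (int (n - Suc k)) (Suc k) = X"
      by (simp_all add: diag_def X_def Y_def d n)
    have ex: "q powi int (Suc k choose 2) = q powi int (k choose 2) * q ^ k"
      using q0 by (simp add: choose_2_Suc power_int_add)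
    have nd: "n - Suc k = Suc d" "n = k + d + 2" by (simp_all add: n d)
    have inv: "q powi (- int (Suc k)) = 1 / (q ^ k * q)"
      by (simp add: power_int_minus divide_inverse del: of_nat_Suc)
    have qn: "q ^ (k + d + 2) = q ^ k * q ^ d * q * q" "q ^ (n' + 1) = q ^ k * q ^ d * q"
      "q ^ Suc d = q ^ d * q" "q ^ Suc k = q ^ k * q"
      by (simp_all add: power_add d power2_eq_square)
    have nz: "1 - q ^ d * q \<noteq> 0"
      using one_minus_q_power_Suc[of d] by (simp add: mult.commute)
    have Y: "Y = X * (1 - q ^ k * q) / (1 - q ^ d * q)"
      using XY nz unfolding qn by (simp add: field_simps)
    \<comment> \<open>With j = k + 1 and the factor 1/q cleared, this is (1 + q^j) (1 - q^n) = 2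
      (q^j - q^n) + (1 + q^n) (1 - q^j), which splits each summand into a term of
      \<open>fibsum 0 n\<close> and one of \<open>fibsum 0 n'\<close>.\<close>
    have core: "q ^ k * (1 + 1 / (q ^ k * q)) * (1 - q ^ k * q ^ d * q * q) / (1 - q ^ d * q) * X
       = 2 * (q ^ k * X) + (q ^ k * q ^ d * q + 1 / q) * Y"
      unfolding Y using nz q0 by (simp add: divide_simps) (simp add: algebra_simps)
    have scale: "(-1) ^ Suc k * (c * t) * w1 * w2 / w3 * x
        = 2 * ((-1) ^ Suc k * (c * t) * x) - u * ((-1) ^ k * c * y)"
      if eq: "t * w1 * w2 / w3 * x = 2 * (t * x) + u * y" for t w1 w2 w3 x u y c :: 'a
    proof -
      have "(-1) ^ Suc k * (c * t) * w1 * w2 / w3 * x = - ((-1) ^ k * c * (t * w1 * w2 / w3 * x))"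
        by simp
      then show ?thesis unfolding eq by (simp add: algebra_simps)
    qed
    show ?thesis
      unfolding dg unfolding nd(1) inv mult_zero_left add_0_right unfolding ex nd(2) qn
      by (rule scale[OF core])
  qed
  have "sum (?f n) {1..<n} = (\<Sum>k\<le>n'. ?f n (Suc k))"
    by (simp only: n add_2_eq_Suc' One_nat_def sum.shift_bounds_Suc_ivl atLeast0LessThan lessThan_Suc_atMost)
  also have "\<dots> = (\<Sum>k\<le>n'. 2 * ((-1) ^ Suc k * q powi (int (Suc k choose 2) + 0 * int (Suc k)) * diag n (Suc k))
      - (q ^ (n' + 1) + 1 / q) * ((-1) ^ k * q powi (int (k choose 2) + 0 * int k) * diag n' k))"
    by (intro sum.cong f) auto
  also have "\<dots> = 2 * (\<Sum>k\<le>n'. (-1) ^ Suc k * q powi (int (Suc k choose 2) + 0 * int (Suc k)) * diag n (Suc k))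
      - (q ^ (n' + 1) + 1 / q) * fibsum 0 n'"
    unfolding fibsum_def sum_subtractf sum_distrib_left ..
  \<comment> \<open>The added term contains \<open>diag n n\<close>, which is zero; the longer range
    is the one that \<open>fibsum_split\<close> requires.\<close>
  also have "(\<Sum>k\<le>n'. (-1) ^ Suc k * q powi (int (Suc k choose 2) + 0 * int (Suc k)) * diag n (Suc k))
     = (\<Sum>k\<le>Suc n'. (-1) ^ Suc k * q powi (int (Suc k choose 2) + 0 * int (Suc k)) * diag n (Suc k))"
    by (simp add: n diag_eq_0)
  also have "\<dots> = fibsum 0 n - 1"
    using fibsum_split[of n "Suc n'" 0] n by simp
  also have "2 * (fibsum 0 n - 1) - (q ^ (n' + 1) + 1 / q) * fibsum 0 n' = calA n q + calB n q - 2"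
    unfolding calA_eq_fibsum[of n', folded n] calB_eq_fibsum[of n', folded n] by (simp add: algebra_simps)
  finally show ?thesis ..
qed

end

section \<open>The localisation of the rational functions at a cyclotomic polynomial\<close>

lemma sum_lessThan_of_nat:
  "(\<Sum>i<m. of_nat i) = (of_nat m * (of_nat m - 1) / 2 :: 'a :: field_char_0)"
  by (induction m) (simp_all add: field_simps)

lemma qvar_conv_to_fract: "qvar = to_fract (monom 1 1)"
  by (simp add: qvar_def to_fract_def monom_altdef)

lemma qvar_power: "qvar ^ k = to_fract (monom 1 k)"
  by (induction k) (simp_all add: qvar_conv_to_fract flip: to_fract_mult add: mult_monom)

lemma qvar_nonzero: "qvar \<noteq> 0"
  by (simp add: qvar_conv_to_fract)

lemma qvar_power_ne_1: "k > 0 \<Longrightarrow> qvar ^ k \<noteq> 1"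
proof
  assume k: "k > 0" and "qvar ^ k = 1"
  then have "to_fract (monom (1::int) k) = to_fract 1" by (simp add: qvar_power)
  then have "monom (1::int) k = 1" by (simp only: to_fract_eq_iff)
  then have "degree (monom (1::int) k) = degree (1 :: int poly)" by simp
  then show False using k by (simp add: degree_monom_eq)
qed

lemma qvar_not_root_of_unity: "\<forall>k>0. qvar ^ k \<noteq> 1"
  using qvar_power_ne_1 by blast

text \<open>In the ring of fractions with denominator coprime to Phi_n(q), this is the ideal
  generated by the e-th power of Phi_n(q); e = 0 gives the ring itself. Congruences become
  membership of differences.\<close>

definition cyc_ideal :: "nat \<Rightarrow> nat \<Rightarrow> int poly fract set" where
  "cyc_ideal n e = {x. \<exists>a b. b \<noteq> 0 \<and> coprime b (cyclotomic n) \<and> x = Fract (cyclotomic n ^ e * a) b}"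

lemma cyc_idealI:
  "b \<noteq> 0 \<Longrightarrow> coprime b (cyclotomic n) \<Longrightarrow> x = Fract (cyclotomic n ^ e * a) b \<Longrightarrow> x \<in> cyc_ideal n e"
  unfolding cyc_ideal_def by blast

lemma rf_cong_if_cyc_ideal:
  "x - y \<in> cyc_ideal n 2 \<Longrightarrow> rf_cong x y (cyclotomic n ^ 2)"
  unfolding cyc_ideal_def rf_cong_def by fastforce

section \<open>Closure properties of the ideals\<close>

context
  fixes n :: nat
  assumes n_pos: "n > 0"
begin

text \<open>Keeps the exponent in \<open>I 1\<close> from being rewritten to
  \<open>Suc 0\<close>.\<close>

declare One_nat_def [simp del]

abbreviation I :: "nat \<Rightarrow> int poly fract set" where "I \<equiv> cyc_ideal n"

lemma cyc_ideal_add: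
  assumes "x \<in> I e" "y \<in> I e"
  shows "x + y \<in> I e"
proof -
  obtain a b c d where 
    "b \<noteq> 0" "coprime b (cyclotomic n)" "x = Fract (cyclotomic n ^ e * a) b"
    "d \<noteq> 0" "coprime d (cyclotomic n)" "y = Fract (cyclotomic n ^ e * c) d"
    using assms by (auto simp: cyc_ideal_def)
  then have "b * d \<noteq> 0 \<and> coprime (b * d) (cyclotomic n)
      \<and> x + y = Fract (cyclotomic n ^ e * (a * d + c * b)) (b * d)"
    by (simp add: algebra_simps)
  then show ?thesis unfolding cyc_ideal_def by blast
qed

lemma cyc_ideal_mult:
  assumes "x \<in> I e" "y \<in> I f"
  shows "x * y \<in> I (e + f)"
proof -
  obtain a b c d where 
    "b \<noteq> 0" "coprime b (cyclotomic n)" "x = Fract (cyclotomic n ^ e * a) b"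
    "d \<noteq> 0" "coprime d (cyclotomic n)" "y = Fract (cyclotomic n ^ f * c) d"
    using assms by (auto simp: cyc_ideal_def)
  then have "b * d \<noteq> 0 \<and> coprime (b * d) (cyclotomic n)
      \<and> x * y = Fract (cyclotomic n ^ (e + f) * (a * c)) (b * d)"
    by (simp add: algebra_simps power_add)
  then show ?thesis unfolding cyc_ideal_def by blast
qed

lemma cyc_ideal_mult_left: "x \<in> I 0 \<Longrightarrow> y \<in> I e \<Longrightarrow> x * y \<in> I e"
  using cyc_ideal_mult[of x 0 y e] by simp

lemma cyc_ideal_mult_right: "x \<in> I e \<Longrightarrow> y \<in> I 0 \<Longrightarrow> x * y \<in> I e"
  using cyc_ideal_mult[of x e y 0] by simp

lemma cyc_ideal_mult_1_1: "x \<in> I 1 \<Longrightarrow> y \<in> I 1 \<Longrightarrow> x * y \<in> I 2"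
  using cyc_ideal_mult[of x 1 y 1] by (simp add: numeral_2_eq_2)

lemma to_fract_in_cyc_ideal: "to_fract p \<in> I 0"
  by (rule cyc_idealI[of 1 _ _ _ p]) (simp_all add: to_fract_def)

lemma one_in_cyc_ideal: "1 \<in> I 0"
  using to_fract_in_cyc_ideal[of 1] by simp

lemma zero_in_cyc_ideal: "0 \<in> I e"
  by (rule cyc_idealI[of 1 _ _ _ 0]) (simp_all add: Zero_fract_def)

lemma cyc_ideal_uminus: "x \<in> I e \<Longrightarrow> - x \<in> I e"
  using cyc_ideal_mult_left[of "to_fract (-1)" x e] to_fract_in_cyc_ideal[of "-1"] by simp

lemma cyc_ideal_diff: "x \<in> I e \<Longrightarrow> y \<in> I e \<Longrightarrow> x - y \<in> I e"
  using cyc_ideal_add[of x e "- y"] cyc_ideal_uminus[of y e] by simp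

lemma cyc_ideal_sum: "(\<And>x. x \<in> A \<Longrightarrow> f x \<in> I e) \<Longrightarrow> sum f A \<in> I e"
  by (induction A rule: infinite_finite_induct) (auto intro: cyc_ideal_add zero_in_cyc_ideal)

lemma of_nat_in_cyc_ideal: "of_nat k \<in> I 0"
  by (induction k) (auto intro: cyc_ideal_add zero_in_cyc_ideal one_in_cyc_ideal)

lemma cyc_ideal_power: "x \<in> I 0 \<Longrightarrow> x ^ k \<in> I 0"
  by (induction k) (auto intro: one_in_cyc_ideal cyc_ideal_mult_left)

lemma cyc_ideal_cong_mult:
  assumes "x - x' \<in> I e" "y - y' \<in> I e" "x \<in> I 0" "y' \<in> I 0"
  shows "x * y - x' * y' \<in> I e"
proof -
  have "x * y - x' * y' = x * (y - y') + (x - x') * y'" by (simp add: algebra_simps)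
  then show ?thesis
    using assms by (simp add: cyc_ideal_add cyc_ideal_mult_left cyc_ideal_mult_right)
qed

section \<open>Units and powers of q in the localisation\<close>

lemma inverse_in_cyc_ideal:
  assumes "coprime b (cyclotomic n)" "b \<noteq> 0"
  shows "1 / to_fract b \<in> I 0"
  using assms by (intro cyc_idealI[of b _ _ _ 1]) (simp_all add: Fract_conv_to_fract)

lemma half_in_cyc_ideal: "1 / 2 \<in> I 0"
proof -
  have "to_fract (2 :: int poly) = 2"
    using to_fract_add[of "1 :: int poly" 1] by simp
  then show ?thesis
    using inverse_in_cyc_ideal[of 2] coprime_2_cyclotomic[of n] by simp
qed

lemma inverse_one_minus_in_cyc_ideal:
  assumes "\<not> n dvd k"
  shows "1 / (1 - qvar ^ k) \<in> I 0"
proof -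
  have "1 - monom (1 :: int) k \<noteq> 0"
  proof
    assume "1 - monom (1 :: int) k = 0"
    then have "qvar ^ k = 1" by (simp add: qvar_power)
    then show False using qvar_power_ne_1[of k] assms by (cases "k = 0") auto
  qed
  then show ?thesis
    using inverse_in_cyc_ideal[of "1 - monom 1 k"] coprime_one_minus_monom_cyclotomic[OF assms]
    by (simp add: qvar_power)
qed

lemma qvar_powi_in_cyc_ideal: "qvar powi i \<in> I 0"
proof (cases "i \<ge> 0")
  case True
  then show ?thesis by (simp add: power_int_def qvar_power to_fract_in_cyc_ideal)
next
  case False
  have "1 / qvar ^ nat (- i) \<in> I 0"
    unfolding qvar_power by (rule inverse_in_cyc_ideal) (simp_all add: coprime_X_cyclotomic)
  then show ?thesis using False by (simp add: power_int_def divide_inverse power_inverse)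
qed

lemma qvar_power_in_cyc_ideal: "qvar ^ k \<in> I 0"
  using qvar_powi_in_cyc_ideal[of "int k"] by simp

lemma one_minus_qvar_power_in_cyc_ideal: "1 - qvar ^ n \<in> I 1"
proof -
  obtain a where "1 - monom 1 n = cyclotomic n * a"
    using cyclotomic_dvd[OF n_pos] by (auto elim: dvdE)
  then have "1 - qvar ^ n = Fract (cyclotomic n ^ 1 * a) 1"
    by (simp add: qvar_power flip: to_fract_def) (metis to_fract_1 to_fract_diff to_fract_mult)
  then show ?thesis by (intro cyc_idealI[of 1 _ _ _ a]) simp_all
qed

lemma one_minus_qvar_power_mult_in_cyc_ideal: "1 - qvar ^ (n * i) \<in> I 1"
proof -
  have "1 - qvar ^ (n * i) = (1 - qvar ^ n) * (\<Sum>j<i. (qvar ^ n) ^ j)"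
    by (simp add: power_mult one_diff_power_eq)
  then show ?thesis
    by (auto intro!: cyc_ideal_mult_right one_minus_qvar_power_in_cyc_ideal cyc_ideal_sum
      cyc_ideal_power qvar_power_in_cyc_ideal)
qed

lemma qvar_powi_cong:
  assumes "int n dvd k - l"
  shows "qvar powi k - qvar powi l \<in> I 1"
proof -
  have main: "qvar powi (l + int (n * i)) - qvar powi l \<in> I 1" for l i
  proof -
    have "qvar powi (l + int (n * i)) - qvar powi l = - (qvar powi l * (1 - qvar ^ (n * i)))"
      using qvar_nonzero by (simp add: power_int_add right_diff_distrib del: of_nat_mult)
    then show ?thesis
      by (auto intro!: cyc_ideal_uminus cyc_ideal_mult_left qvar_powi_in_cyc_ideal
        one_minus_qvar_power_mult_in_cyc_ideal)
  qed
  obtain t where t: "k - l = int n * t" using assms by (auto elim: dvdE)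
  show ?thesis
  proof (cases "t \<ge> 0")
    case True
    then have "k = l + int (n * nat t)" using t by simp
    then show ?thesis using main[of l "nat t"] by (simp only:)
  next
    case False
    then have "l = k + int (n * nat (- t))" using t by simp
    then have "qvar powi l - qvar powi k \<in> I 1" using main[of k "nat (- t)"] by (simp only:)
    then show ?thesis using cyc_ideal_uminus[of "qvar powi l - qvar powi k"] by simp
  qed
qed

text \<open>First-order expansion of 1 - (1 - \<epsilon>)^i; the correction in each step is a
  product of two elements of \<open>I 1\<close>.\<close>

lemma one_minus_qvar_power_mult_cong:
  "1 - qvar ^ (n * i) - of_nat i * (1 - qvar ^ n) \<in> I 2"
proof (induction i)
  case 0
  then show ?case by (simp add: zero_in_cyc_ideal)
next
  case (Suc i)
  have "1 - qvar ^ (n * Suc i) - of_nat (Suc i) * (1 - qvar ^ n)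
    = (1 - qvar ^ (n * i) - of_nat i * (1 - qvar ^ n)) - (1 - qvar ^ (n * i)) * (1 - qvar ^ n)"
    by (simp add: power_add algebra_simps)
  then show ?case
    by (simp only:) (intro cyc_ideal_diff[OF Suc] cyc_ideal_mult_1_1
      one_minus_qvar_power_mult_in_cyc_ideal one_minus_qvar_power_in_cyc_ideal)
qed

section \<open>Gaussian binomials in the localisation\<close>

lemma gbin_in_cyc_ideal: "k < n \<Longrightarrow> gbin qvar N k \<in> I 0"
proof (induction k)
  case (Suc k)
  have "\<not> n dvd Suc k" using Suc.prems by (auto dest: dvd_imp_le)
  then have "gbin qvar N k * ((1 - qvar powi (N - int k)) * (1 / (1 - qvar ^ Suc k))) \<in> I 0"
    using Suc by (intro cyc_ideal_mult_left inverse_one_minus_in_cyc_ideal cyc_ideal_diff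
      one_in_cyc_ideal qvar_powi_in_cyc_ideal) auto
  then show ?case by (simp add: gbin_Suc)
qed (simp add: one_in_cyc_ideal)

text \<open>The upper index enters only through powers of q, which have period n modulo Phi_n(q),
  and k < n keeps the denominators invertible. Negative representatives are allowed: mn - 1 may
  become -1, and n - j may become -j.\<close>

lemma gbin_cong:
  assumes "k < n" "int n dvd N - N'"
  shows "gbin qvar N k - gbin qvar N' k \<in> I 1"
  using assms(1)
proof (induction k)
  case (Suc k)
  have nd: "\<not> n dvd Suc k" using Suc.prems by (auto dest: dvd_imp_le)
  have "(1 - qvar powi (N - int k)) - (1 - qvar powi (N' - int k)) = - (qvar powi (N - int k) - qvar powi (N' - int k))"
    by simp
  also have "\<dots> \<in> I 1"
    using assms(2) by (intro cyc_ideal_uminus qvar_powi_cong) simp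
  finally have "gbin qvar N k * (1 - qvar powi (N - int k)) - gbin qvar N' k * (1 - qvar powi (N' - int k)) \<in> I 1"
    using Suc by (intro cyc_ideal_cong_mult gbin_in_cyc_ideal
      cyc_ideal_diff[OF one_in_cyc_ideal qvar_powi_in_cyc_ideal]) auto
  then have "(gbin qvar N k * (1 - qvar powi (N - int k)) - gbin qvar N' k * (1 - qvar powi (N' - int k)))
      * (1 / (1 - qvar ^ Suc k)) \<in> I 1"
    by (intro cyc_ideal_mult_right inverse_one_minus_in_cyc_ideal nd)
  then show ?case by (simp add: gbin_Suc diff_divide_distrib)
qed (simp add: zero_in_cyc_ideal)

text \<open>In the expanded product, all terms with two or more factors \<open>f x\<close> lie in
  \<open>I 2\<close>.\<close>

lemma cyc_ideal_prod_one_plus: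
  assumes "\<And>x. x \<in> A \<Longrightarrow> f x \<in> I 1"
  shows "(\<Prod>x\<in>A. 1 + f x) - (1 + sum f A) \<in> I 2"
  using assms
proof (induction A rule: infinite_finite_induct)
  case (insert x A)
  have "(\<Prod>y\<in>insert x A. 1 + f y) - (1 + sum f (insert x A))
    = (1 + f x) * ((\<Prod>y\<in>A. 1 + f y) - (1 + sum f A)) + f x * sum f A"
    using insert.hyps by (simp add: algebra_simps)
  moreover have "1 + f x \<in> I 0"
  proof -
    have "f x \<in> I 0"
    proof -
      obtain a b where "b \<noteq> 0" "coprime b (cyclotomic n)" "f x = Fract (cyclotomic n ^ 1 * a) b"
        using insert.prems[of x] by (auto simp: cyc_ideal_def)
      then show ?thesis by (intro cyc_idealI[of b _ _ _ "cyclotomic n * a"]) simp_all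
    qed
    then show ?thesis by (intro cyc_ideal_add one_in_cyc_ideal)
  qed
  then have "(1 + f x) * ((\<Prod>y\<in>A. 1 + f y) - (1 + sum f A)) \<in> I 2"
    using insert by (intro cyc_ideal_mult_left) auto
  moreover have "f x * sum f A \<in> I 2"
    using insert.prems by (intro cyc_ideal_mult_1_1 cyc_ideal_sum) auto
  ultimately show ?case by (simp only:) (rule cyc_ideal_add)
qed (simp_all add: zero_in_cyc_ideal)

section \<open>The terms of the trinomial coefficient\<close>

text \<open>Pairing j with n - j: the two summands plus 1 equal (1 - q^n) / ((1 - q^j) (1 -
  q^(n-j))).\<close>

lemma sum_qvar_geometric_cong:
  "2 * (\<Sum>j\<in>{1..<n}. qvar ^ j / (1 - qvar ^ j)) + (of_nat n - 1) \<in> I 1"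
proof -
  let ?y = "\<lambda>j. qvar ^ j / (1 - qvar ^ j)"
  have pair: "?y j + ?y (n - j) + 1 \<in> I 1" if j: "j \<in> {1..<n}" for j
  proof -
    have nz: "1 - qvar ^ j \<noteq> 0" "1 - qvar ^ (n - j) \<noteq> 0"
      using qvar_power_ne_1[of j] qvar_power_ne_1[of "n - j"] j by auto
    have nd: "\<not> n dvd j" "\<not> n dvd (n - j)" using j by (auto dest: dvd_imp_le)
    have "qvar ^ n = qvar ^ j * qvar ^ (n - j)" using j by (simp flip: power_add)
    then have "?y j + ?y (n - j) + 1 = (1 - qvar ^ n) * (1 / (1 - qvar ^ j) * (1 / (1 - qvar ^ (n - j))))"
      using nz by (simp add: divide_simps) (simp add: algebra_simps)
    then show ?thesis
      by (simp only:) (intro cyc_ideal_mult_right cyc_ideal_mult_left one_minus_qvar_power_in_cyc_ideal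
        inverse_one_minus_in_cyc_ideal nd)
  qed
  have "sum ?y {1..<n} = (\<Sum>j\<in>{1..<n}. ?y (n - j))"
    by (rule sum.reindex_bij_witness[of _ "\<lambda>j. n - j" "\<lambda>j. n - j"]) auto
  then have "2 * sum ?y {1..<n} + (of_nat n - 1) = (\<Sum>j\<in>{1..<n}. ?y j + ?y (n - j) + 1)"
    using n_pos by (simp add: sum.distrib of_nat_diff)
  then show ?thesis by (simp only:) (intro cyc_ideal_sum pair)
qed

text \<open>Puts every factor into the form 1 plus an element of \<open>I 1\<close>, ready for
  linearisation.\<close>

lemma gbin_pred_eq_prod:
  assumes "m > 0"
  shows "gbin qvar (int (m * n) - 1) (n - 1)
    = (\<Prod>j\<in>{1..<n}. 1 + qvar ^ j * (1 - qvar ^ (n * (m - 1))) * (1 / (1 - qvar ^ j)))"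
proof -
  have mn: "m * n = n * (m - 1) + n" using assms by (cases m) auto
  have num: "(\<Prod>i<n-1. 1 - qvar powi (int (m * n) - 1 - int i)) = (\<Prod>j\<in>{1..<n}. 1 - qvar ^ (n * (m - 1) + j))"
  proof (rule prod.reindex_bij_witness[of _ "\<lambda>j. n - 1 - j" "\<lambda>j. n - 1 - j"])
    fix i assume i: "i \<in> {..<n-1}"
    have "int (m * n) - 1 - int i = int (n * (m - 1) + (n - 1 - i))"
      using i mn by (simp add: of_nat_diff)
    then show "1 - qvar ^ (n * (m - 1) + (n - 1 - i)) = 1 - qvar powi (int (m * n) - 1 - int i)"
      by (simp only: power_int_of_nat)
  qed auto
  have den: "(\<Prod>i<n-1. 1 - qvar ^ Suc i) = (\<Prod>j\<in>{1..<n}. 1 - qvar ^ j)"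
    by (rule prod.reindex_bij_witness[of _ "\<lambda>j. j - 1" Suc]) auto
  have "gbin qvar (int (m * n) - 1) (n - 1)
      = (\<Prod>j\<in>{1..<n}. (1 - qvar ^ (n * (m - 1) + j)) / (1 - qvar ^ j))"
    unfolding gbin_def prod_dividef num den ..
  also have "\<dots> = (\<Prod>j\<in>{1..<n}. 1 + qvar ^ j * (1 - qvar ^ (n * (m - 1))) * (1 / (1 - qvar ^ j)))"
  proof (rule prod.cong)
    fix j assume "j \<in> {1..<n}"
    then have "1 - qvar ^ j \<noteq> 0" using qvar_power_ne_1[of j] by simp
    then show "(1 - qvar ^ (n * (m - 1) + j)) / (1 - qvar ^ j)
        = 1 + qvar ^ j * (1 - qvar ^ (n * (m - 1))) * (1 / (1 - qvar ^ j))"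
      by (simp add: divide_simps power_add) (simp add: algebra_simps)
  qed simp
  finally show ?thesis .
qed

lemma gbin_pred_cong:
  assumes "m > 0"
  shows "gbin qvar (int (m * n) - 1) (n - 1)
    - (1 - (of_nat n - 1) * (of_nat m - 1) / 2 * (1 - qvar ^ n)) \<in> I 2"
proof -
  let ?e = "1 - qvar ^ n" and ?y = "\<lambda>j. qvar ^ j * (1 / (1 - qvar ^ j))"
  define E where "E = 1 - qvar ^ (n * (m - 1))"
  define S where "S = sum ?y {1..<n}"
  have nd: "\<not> n dvd j" if "j \<in> {1..<n}" for j using that by (auto dest: dvd_imp_le)
  have E1: "E \<in> I 1" unfolding E_def by (rule one_minus_qvar_power_mult_in_cyc_ideal)
  have E2: "E - (of_nat m - 1) * ?e \<in> I 2"
    using one_minus_qvar_power_mult_cong[of "m - 1"] assms unfolding E_def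
    by (simp add: of_nat_diff)
  have y0: "?y j \<in> I 0" if "j \<in> {1..<n}" for j
    using nd[OF that] by (intro cyc_ideal_mult_left qvar_power_in_cyc_ideal inverse_one_minus_in_cyc_ideal)
  have S0: "S \<in> I 0" unfolding S_def by (intro cyc_ideal_sum y0)
  have "2 * S + (of_nat n - 1) \<in> I 1"
    using sum_qvar_geometric_cong unfolding S_def by simp
  then have "1 / 2 * (2 * S + (of_nat n - 1)) \<in> I 1"
    by (intro cyc_ideal_mult_left half_in_cyc_ideal)
  then have S1: "S + (of_nat n - 1) / 2 \<in> I 1" by (simp add: field_simps)
  have "(\<Prod>j\<in>{1..<n}. 1 + E * ?y j) - (1 + (\<Sum>j\<in>{1..<n}. E * ?y j)) \<in> I 2"
    by (intro cyc_ideal_prod_one_plus cyc_ideal_mult_right E1 y0)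
  moreover have "(\<Prod>j\<in>{1..<n}. 1 + E * ?y j) = gbin qvar (int (m * n) - 1) (n - 1)"
    unfolding gbin_pred_eq_prod[OF assms] E_def by (simp only: mult_ac)
  ultimately have 1: "gbin qvar (int (m * n) - 1) (n - 1) - (1 + E * S) \<in> I 2"
    by (simp only: S_def sum_distrib_left)
  have 2: "(E - (of_nat m - 1) * ?e) * S \<in> I 2"
    by (intro cyc_ideal_mult_right E2 S0)
  have "of_nat (m - 1) * (?e * (S + (of_nat n - 1) / 2)) \<in> I 2"
    by (intro cyc_ideal_mult_left cyc_ideal_mult_1_1 of_nat_in_cyc_ideal S1 one_minus_qvar_power_in_cyc_ideal)
  then have 3: "(of_nat m - 1) * (?e * (S + (of_nat n - 1) / 2)) \<in> I 2"
    using assms by (simp add: of_nat_diff)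
  \<comment> \<open>The linearised product is 1 + E S. Here E is needed to second order, E = (m - 1)
    \<epsilon>, but S only to first order, S = -(n - 1)/2, because E already lies in
    \<open>I 1\<close>.\<close>
  have "gbin qvar (int (m * n) - 1) (n - 1) - (1 - (of_nat n - 1) * (of_nat m - 1) / 2 * ?e)
     = (gbin qvar (int (m * n) - 1) (n - 1) - (1 + E * S)) + (E - (of_nat m - 1) * ?e) * S
       + (of_nat m - 1) * (?e * (S + (of_nat n - 1) / 2))"
    by (simp add: field_simps)
  then show ?thesis
    by (simp only:) (intro cyc_ideal_add 1 2 3)
qed

lemma of_nat_half_in_cyc_ideal: "of_nat k / 2 \<in> I 0"
  using cyc_ideal_mult_left[OF of_nat_in_cyc_ideal half_in_cyc_ideal, of k] by simp

lemma qvar_geometric_cong: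
  "(\<Sum>i<m. qvar ^ (n * i)) - (of_nat m - of_nat m * (of_nat m - 1) / 2 * (1 - qvar ^ n)) \<in> I 2"
proof -
  have "(\<Sum>i<m. - (1 - qvar ^ (n * i) - of_nat i * (1 - qvar ^ n))) \<in> I 2"
    by (intro cyc_ideal_sum cyc_ideal_uminus one_minus_qvar_power_mult_cong)
  also have "(\<Sum>i<m. - (1 - qvar ^ (n * i) - of_nat i * (1 - qvar ^ n)))
     = (\<Sum>i<m. qvar ^ (n * i)) - (of_nat m - of_nat m * (of_nat m - 1) / 2 * (1 - qvar ^ n))"
    by (simp add: sum_subtractf sum.distrib flip: sum_lessThan_of_nat sum_distrib_right)
  finally show ?thesis .
qed

text \<open>The denominator 1 - q^n is not invertible, so it is first cancelled exactly: absorption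
  gives [mn, n] as (1 - q^(mn)) / (1 - q^n), a geometric sum, times [mn - 1, n - 1]. Both factors
  are known to second order.\<close>

lemma gbin_mult_cong:
  assumes "m > 0"
  shows "gbin qvar (int (m * n)) n
    - (of_nat m - of_nat n * of_nat m * (of_nat m - 1) / 2 * (1 - qvar ^ n)) \<in> I 2"
proof -
  let ?e = "1 - qvar ^ n"
  define S where "S = (\<Sum>i<m. qvar ^ (n * i))"
  define P where "P = gbin qvar (int (m * n) - 1) (n - 1)"
  define S' where "S' = of_nat m - of_nat m * (of_nat m - 1) / 2 * ?e"
  define P' where "P' = 1 - (of_nat n - 1) * (of_nat m - 1) / 2 * ?e"
  have nz: "?e \<noteq> 0" using qvar_power_ne_1[OF n_pos] by simp
  have "1 - qvar ^ (m * n) = ?e * S"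
    unfolding S_def by (simp add: one_diff_power_eq mult.commute[of m] power_mult)
  moreover have "gbin qvar (int (m * n)) n * ?e = (1 - qvar ^ (m * n)) * P"
    using gbin_absorb[OF qvar_nonzero qvar_not_root_of_unity, of "int (m * n)" "n - 1"] n_pos
    unfolding P_def power_int_of_nat by simp
  ultimately have G: "gbin qvar (int (m * n)) n = S * P"
    using nz by simp
  have nm: "(of_nat n - 1) * (of_nat m - 1) / 2 = (of_nat ((n - 1) * (m - 1)) / 2 :: int poly fract)"
    using n_pos assms by (simp add: of_nat_diff)
  have mm: "of_nat m * (of_nat m - 1) / 2 = (of_nat (m * (m - 1)) / 2 :: int poly fract)"
    using assms by (simp add: of_nat_diff)
  have S0: "S \<in> I 0" unfolding S_def by (intro cyc_ideal_sum qvar_power_in_cyc_ideal)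
  have P0: "P' \<in> I 0"
    unfolding P'_def nm by (intro cyc_ideal_diff one_in_cyc_ideal cyc_ideal_mult_left
       of_nat_half_in_cyc_ideal qvar_power_in_cyc_ideal)
  have 1: "S * P - S' * P' \<in> I 2"
    using qvar_geometric_cong gbin_pred_cong[OF assms] S0 P0 unfolding S_def P_def S'_def P'_def
    by (intro cyc_ideal_cong_mult)
  have 2: "of_nat (m * (m - 1)) / 2 * (of_nat ((n - 1) * (m - 1)) / 2) * (?e * ?e) \<in> I 2"
    by (intro cyc_ideal_mult_left cyc_ideal_mult_1_1 of_nat_half_in_cyc_ideal
      one_minus_qvar_power_in_cyc_ideal)
  \<comment> \<open>The linear coefficients m(m-1)/2 and m(n-1)(m-1)/2 add up to nm(m-1)/2; only the
    product of the two linear terms is left over.\<close>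
  have "S * P - (of_nat m - of_nat n * of_nat m * (of_nat m - 1) / 2 * ?e)
    = (S * P - S' * P') + of_nat (m * (m - 1)) / 2 * (of_nat ((n - 1) * (m - 1)) / 2) * (?e * ?e)"
    unfolding S'_def P'_def nm[symmetric] mm[symmetric] by (simp add: field_simps)
  then show ?thesis
    unfolding G by (simp only:) (intro cyc_ideal_add 1 2)
qed

text \<open>For odd n the exponent is a multiple of n. For n = 2h, 1 - q^h is invertible, so 1 - q^n
  = (1 + q^h) (1 - q^h) forces q^h to be -1 modulo Phi_n(q).\<close>

lemma triangular_power_cong: "1 + (-1) ^ n * qvar ^ (n * (n + 1) div 2) \<in> I 1"
proof (cases "odd n")
  case True
  then have "2 dvd n + 1" by simp
  then have "n * (n + 1) div 2 = n * ((n + 1) div 2)" by (rule div_mult_swap[symmetric])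
  then show ?thesis
    using one_minus_qvar_power_mult_in_cyc_ideal[of "(n + 1) div 2"] True by simp
next
  case False
  then obtain h where h: "n = 2 * h" by auto
  with n_pos have "\<not> n dvd h" by (auto dest: dvd_imp_le)
  then have "(1 - qvar ^ n) * (1 / (1 - qvar ^ h)) \<in> I 1"
    by (intro cyc_ideal_mult_right inverse_one_minus_in_cyc_ideal one_minus_qvar_power_in_cyc_ideal)
  moreover have "qvar ^ n = qvar ^ h * qvar ^ h"
    by (simp add: h mult_2 power_add)
  then have "1 - qvar ^ n = (1 + qvar ^ h) * (1 - qvar ^ h)"
    by (simp add: algebra_simps)
  moreover have "1 - qvar ^ h \<noteq> 0" using qvar_power_ne_1[of h] n_pos h by simp
  ultimately have 1: "1 + qvar ^ h \<in> I 1" by simp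
  have "n * (n + 1) div 2 = n * h + h" by (simp add: h algebra_simps)
  then have "1 + (-1) ^ n * qvar ^ (n * (n + 1) div 2)
      = (1 + qvar ^ h) - qvar ^ h * (1 - qvar ^ (n * h))"
    using False by (simp add: power_add algebra_simps)
  then show ?thesis
    by (simp only:) (intro cyc_ideal_diff 1 cyc_ideal_mult_left qvar_power_in_cyc_ideal
      one_minus_qvar_power_mult_in_cyc_ideal)
qed

section \<open>Middle terms of the trinomial sum\<close>

text \<open>Modulo n the upper indices mn - 1, 2mn - 2(n - j) and n - j reduce to -1, 2j and -j. The
  first coefficient becomes a signed power of q, and \<open>gbin_central_reflect\<close> relates the
  other two.\<close>

lemma gbin_middle_cong:
  assumes "0 < j" "j < n"
  shows "(-1) ^ (n - j) * qvar powi (int (m * n) * int (n - j) - int ((n - j) choose 2))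
      * gbin qvar (int (m * n) - 1) (n - j - 1) * gbin qvar (2 * int (m * n) - 2 * int (n - j)) j
    + (-1) ^ j * qvar powi int (j choose 2) * (1 + qvar powi (- int j)) * gbin qvar (int (n - j)) j \<in> I 1"
proof -
  obtain i where i: "n - j = Suc i" using assms by (cases "n - j") auto
  then have n: "n = j + Suc i" using assms by simp
  define b where "b = gbin qvar (2 * int j) j"
  define E where "E = int (m * n) * int (Suc i) - int ((Suc i) choose 2)"
  define c where "c = int (Suc i choose 2)"
  define w where "w = int j * int j + int j"
  have b0: "b \<in> I 0" unfolding b_def by (rule gbin_in_cyc_ideal[OF assms(2)])
  have s0: "(-1) ^ k * qvar powi l \<in> I 0" for k l
    by (intro cyc_ideal_mult_left cyc_ideal_power cyc_ideal_uminus one_in_cyc_ideal qvar_powi_in_cyc_ideal)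
  have 1: "gbin qvar (int (m * n) - 1) i - (-1) ^ i * qvar powi (- c) \<in> I 1"
    using gbin_cong[of i "int (m * n) - 1" "-1"] assms i
    unfolding gbin_uminus_1[OF qvar_nonzero qvar_not_root_of_unity] c_def by simp
  have 2: "gbin qvar (2 * int (m * n) - 2 * int (Suc i)) j - b \<in> I 1"
    unfolding b_def
  proof (rule gbin_cong[OF assms(2)])
    have "2 * int (m * n) - 2 * int (Suc i) - 2 * int j = int n * (2 * int m - 2)"
      by (simp add: n algebra_simps)
    then show "int n dvd 2 * int (m * n) - 2 * int (Suc i) - 2 * int j" by simp
  qed
  have "gbin qvar (int (m * n) - 1) i * gbin qvar (2 * int (m * n) - 2 * int (Suc i)) j
      - (-1) ^ i * qvar powi (- c) * b \<in> I 1"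
    using 1 2 b0 n by (intro cyc_ideal_cong_mult gbin_in_cyc_ideal) auto
  then have "(-1) ^ Suc i * qvar powi E * (gbin qvar (int (m * n) - 1) i
      * gbin qvar (2 * int (m * n) - 2 * int (Suc i)) j - (-1) ^ i * qvar powi (- c) * b) \<in> I 1"
    by (intro cyc_ideal_mult_left[OF s0])
  moreover have "(-1) ^ Suc i * qvar powi E * ((-1) ^ i * qvar powi (- c) * b) = - (qvar powi (E - c) * b)"
  proof -
    have "qvar powi E * qvar powi (- c) = qvar powi (E - c)"
      using qvar_nonzero by (simp flip: power_int_add)
    moreover have "(-1) ^ Suc i * (-1) ^ i = (-1 :: int poly fract)"
      by (simp flip: power_add mult_2)
    moreover have "(-1) ^ Suc i * qvar powi E * ((-1) ^ i * qvar powi (- c) * b)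
        = ((-1) ^ Suc i * (-1) ^ i) * (qvar powi E * qvar powi (- c)) * b"
      by (simp only: mult_ac)
    ultimately show ?thesis by simp
  qed
  ultimately have 3: "(-1) ^ Suc i * qvar powi E * gbin qvar (int (m * n) - 1) i
      * gbin qvar (2 * int (m * n) - 2 * int (Suc i)) j + qvar powi (E - c) * b \<in> I 1"
    by (simp only: right_diff_distrib mult.assoc) simp
  \<comment> \<open>As i + 1 = n - j, one has 2c = (n - j) (n - j - 1), which is j (j + 1) = w
    modulo n.\<close>
  have 4: "(qvar powi (E - c) - qvar powi (- w)) * b \<in> I 1"
  proof (intro cyc_ideal_mult_right[OF _ b0] qvar_powi_cong)
    have "2 * c = int (Suc i) * int i"
      unfolding c_def using two_choose_2[of i] by (metis of_nat_mult of_nat_numeral)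
    then have "E - c - (- w) = int (m * n) * int (Suc i) - int (Suc i) * int i + w"
      unfolding E_def c_def by simp
    also have "\<dots> = int n * (int m * int (Suc i) + int j + 1 - int (Suc i))"
      unfolding w_def n by (simp add: algebra_simps)
    finally show "int n dvd E - c - (- w)" by simp
  qed
  have 5: "gbin qvar (int (Suc i)) j - gbin qvar (- int j) j \<in> I 1"
    using n by (intro gbin_cong[OF assms(2)]) (simp add: algebra_simps)
  have "(-1) ^ j * qvar powi int (j choose 2) * (1 + qvar powi (- int j)) \<in> I 0"
    by (intro cyc_ideal_mult_left[OF s0] cyc_ideal_add one_in_cyc_ideal qvar_powi_in_cyc_ideal)
  then have "(-1) ^ j * qvar powi int (j choose 2) * (1 + qvar powi (- int j))
      * (gbin qvar (int (Suc i)) j - gbin qvar (- int j) j) \<in> I 1"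
    by (rule cyc_ideal_mult_left[OF _ 5])
  moreover have "(-1) ^ j * qvar powi int (j choose 2) * (1 + qvar powi (- int j)) * gbin qvar (- int j) j
      = qvar powi (- w) * b"
  proof -
    have "(-1) ^ j * qvar powi int (j choose 2) * (1 + qvar powi (- int j)) * gbin qvar (- int j) j
       = (-1) ^ j * qvar powi int (j choose 2) * ((1 + qvar powi (- int j)) * gbin qvar (- int j) j)"
      by (simp only: mult.assoc)
    also have "\<dots> = ((-1) ^ j * (-1) ^ j) * (qvar powi int (j choose 2)
        * qvar powi (- (int j * int j + int (j choose 2) + int j))) * b"
      unfolding gbin_central_reflect[OF qvar_nonzero qvar_not_root_of_unity assms(1)] b_def by (simp only: mult_ac)
    also have "(-1) ^ j * (-1) ^ j = (1 :: int poly fract)"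
      by (simp flip: power_mult_distrib)
    also have "qvar powi int (j choose 2) * qvar powi (- (int j * int j + int (j choose 2) + int j))
        = qvar powi (- w)"
      using qvar_nonzero unfolding w_def by (simp flip: power_int_add power_int_of_nat)
    finally show ?thesis by simp
  qed
  ultimately have 6: "(-1) ^ j * qvar powi int (j choose 2) * (1 + qvar powi (- int j)) * gbin qvar (int (Suc i)) j
      - qvar powi (- w) * b \<in> I 1"
    by (simp only: right_diff_distrib)
  have "x + y \<in> I 1" if "x + u * b \<in> I 1" "(u - v) * b \<in> I 1" "y - v * b \<in> I 1" for x y u v
  proof -
    have "x + y = (x + u * b) - (u - v) * b + (y - v * b)" by (simp add: algebra_simps)
    then show ?thesis
      using cyc_ideal_add[OF cyc_ideal_diff[OF that(1,2)] that(3)] by (simp only:)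
  qed
  from this[OF 3 4 6] show ?thesis
    unfolding i E_def by simp
qed

text \<open>The j-th summand of A_n + B_n - 2 with its factor 1 - q^n removed; the quotient matters
  only to first order.\<close>

definition calterm :: "nat \<Rightarrow> int poly fract" where
  "calterm j = (-1) ^ j * qvar powi int (j choose 2) * (1 + qvar powi (- int j)) * gbin qvar (int (n - j)) j
     * (1 / (1 - qvar ^ (n - j)))"

lemma calA_plus_calB_calterm: "calA n qvar + calB n qvar - 2 = (\<Sum>j\<in>{1..<n}. (1 - qvar ^ n) * calterm j)"
  unfolding calA_plus_calB[OF qvar_nonzero qvar_not_root_of_unity n_pos] calterm_def
  by (intro sum.cong refl) simp

lemma calterm_in_cyc_ideal: "j \<in> {1..<n} \<Longrightarrow> calterm j \<in> I 0"
  unfolding calterm_def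
  by (intro cyc_ideal_mult_left cyc_ideal_power cyc_ideal_uminus cyc_ideal_add one_in_cyc_ideal
    qvar_powi_in_cyc_ideal gbin_in_cyc_ideal inverse_one_minus_in_cyc_ideal)
    (auto dest: dvd_imp_le)

text \<open>Absorption extracts 1 - q^(mn), congruent to m \<epsilon>, from [mn, n - j]; the
  cofactor is then needed only modulo Phi_n(q), where \<open>gbin_middle_cong\<close>
  applies.\<close>

lemma tau0_middle_term_cong:
  assumes j: "j \<in> {1..<n}"
  shows "(-1) ^ (n - j) * qvar powi (int (m * n) * int (n - j) - int ((n - j) choose 2))
      * gbin qvar (int (m * n)) (n - j) * gbin qvar (2 * int (m * n) - 2 * int (n - j)) j
    + of_nat m * ((1 - qvar ^ n) * calterm j) \<in> I 2"
proof -
  let ?e = "1 - qvar ^ n"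
  define s where "s = (-1) ^ (n - j) * qvar powi (int (m * n) * int (n - j) - int ((n - j) choose 2))"
  define g where "g = gbin qvar (int (m * n) - 1) (n - j - 1)"
  define h where "h = gbin qvar (2 * int (m * n) - 2 * int (n - j)) j"
  define v where "v = 1 / (1 - qvar ^ (n - j))"
  have nd: "\<not> n dvd n - j" using j by (auto dest: dvd_imp_le)
  have v0: "v \<in> I 0" unfolding v_def by (intro inverse_one_minus_in_cyc_ideal nd)
  have s0: "s \<in> I 0" unfolding s_def
    by (intro cyc_ideal_mult_left cyc_ideal_power cyc_ideal_uminus one_in_cyc_ideal qvar_powi_in_cyc_ideal)
  have g0: "g \<in> I 0" "h \<in> I 0" unfolding g_def h_def using j by (auto intro!: gbin_in_cyc_ideal)
  have nz: "1 - qvar ^ (n - j) \<noteq> 0" using qvar_power_ne_1[of "n - j"] j by simp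
  have Suc: "Suc (n - j - 1) = n - j" using j unfolding atLeastLessThan_iff by arith
  have "gbin qvar (int (m * n)) (n - j) * (1 - qvar ^ (n - j)) = (1 - qvar ^ (n * m)) * g"
    using gbin_absorb[OF qvar_nonzero qvar_not_root_of_unity, of "int (m * n)" "n - j - 1"]
    unfolding Suc g_def power_int_of_nat mult.commute[of n m] .
  then have G: "gbin qvar (int (m * n)) (n - j) = (1 - qvar ^ (n * m)) * g * v"
    using nz by (simp add: v_def field_simps)
  have "(s * g * h + (-1) ^ j * qvar powi int (j choose 2) * (1 + qvar powi (- int j))
      * gbin qvar (int (n - j)) j) * v \<in> I 1"
    using gbin_middle_cong[of j m] j unfolding s_def g_def h_def
    by (intro cyc_ideal_mult_right v0) auto
  then have 1: "s * g * h * v + calterm j \<in> I 1"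
    by (simp only: calterm_def v_def[symmetric] distrib_right)
  have 2: "of_nat m * (?e * (s * g * h * v + calterm j)) \<in> I 2"
    by (intro cyc_ideal_mult_left cyc_ideal_mult_1_1 of_nat_in_cyc_ideal
      one_minus_qvar_power_in_cyc_ideal 1)
  have 3: "(1 - qvar ^ (n * m) - of_nat m * ?e) * (s * g * h * v) \<in> I 2"
    by (intro cyc_ideal_mult_right[OF one_minus_qvar_power_mult_cong]
       cyc_ideal_mult_left s0 g0 v0)
  have "s * ((1 - qvar ^ (n * m)) * g * v) * h + of_nat m * (?e * calterm j)
      = of_nat m * (?e * (s * g * h * v + calterm j)) + (1 - qvar ^ (n * m) - of_nat m * ?e) * (s * g * h * v)"
    by (simp add: algebra_simps)
  then show ?thesis
    unfolding G s_def[symmetric] h_def[symmetric] by (simp only:) (intro cyc_ideal_add 2 3)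
qed

section \<open>Outer terms and the splitting of the trinomial coefficient\<close>

text \<open>The exponent is n(n+1)/2 + nt with t = n(m-1). The factor q^(nt) = 1 - t \<epsilon>
  contributes nm(m-1) to the coefficient of -\<epsilon> and [mn, n] contributes nm(m-1)/2, whence
  the 3/2.\<close>

lemma tau0_last_term_cong:
  assumes "m > 0"
  shows "(-1) ^ n * qvar powi (int (m * n) * int n - int (n choose 2)) * gbin qvar (int (m * n)) n
    - (-1) ^ n * qvar ^ (n * (n + 1) div 2)
      * (of_nat m - 3 * of_nat n * of_nat m * (of_nat m - 1) / 2 * (1 - qvar ^ n)) \<in> I 2"
proof -
  let ?e = "1 - qvar ^ n"
  define t where "t = n * (m - 1)"
  define u where "u = (-1) ^ n * qvar ^ (n * (n + 1) div 2)"
  define G where "G = gbin qvar (int (m * n)) n"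
  have tm: "of_nat t = (of_nat n * (of_nat m - 1) :: int poly fract)"
    using assms by (simp add: t_def of_nat_diff)
  have "2 * (n choose 2) = n * (n - 1)"
    using two_choose_2[of "n - 1"] n_pos by simp
  moreover have "2 * (n * (n + 1) div 2) = n * (n + 1)" by simp
  moreover have "2 * (m * n * n) = n * (n - 1) + n * (n + 1) + 2 * (n * t)"
    using assms n_pos by (cases m; cases n) (simp_all add: t_def algebra_simps)
  ultimately have "int (m * n) * int n - int (n choose 2) = int (n * (n + 1) div 2 + n * t)"
    by (simp only: flip: of_nat_mult)
  then have "qvar powi (int (m * n) * int n - int (n choose 2)) = qvar ^ (n * (n + 1) div 2) * qvar ^ (n * t)"
    by (simp only: power_int_of_nat power_add)
  then have eq: "(-1) ^ n * qvar powi (int (m * n) * int n - int (n choose 2)) * G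
      = u * (qvar ^ (n * t) * G)"
    unfolding u_def by (simp only: mult.assoc)
  have u0: "u \<in> I 0" unfolding u_def
    by (intro cyc_ideal_mult_left cyc_ideal_power cyc_ideal_uminus one_in_cyc_ideal qvar_power_in_cyc_ideal)
  have h0: "of_nat m - of_nat n * of_nat m * (of_nat m - 1) / 2 * ?e \<in> I 0"
  proof -
    have "of_nat m - of_nat (n * m * (m - 1)) / 2 * ?e \<in> I 0"
      by (intro cyc_ideal_diff cyc_ideal_mult_left of_nat_half_in_cyc_ideal of_nat_in_cyc_ideal
        one_in_cyc_ideal qvar_power_in_cyc_ideal)
    then show ?thesis using assms by (simp add: of_nat_diff)
  qed
  have "qvar ^ (n * t) - (1 - of_nat t * ?e) = - (1 - qvar ^ (n * t) - of_nat t * ?e)" by simp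
  also have "\<dots> \<in> I 2" by (intro cyc_ideal_uminus one_minus_qvar_power_mult_cong)
  finally have 1: "qvar ^ (n * t) * G - (1 - of_nat t * ?e)
      * (of_nat m - of_nat n * of_nat m * (of_nat m - 1) / 2 * ?e) \<in> I 2"
    using gbin_mult_cong[OF assms] h0 unfolding G_def
    by (intro cyc_ideal_cong_mult qvar_power_in_cyc_ideal)
  have "of_nat t * (of_nat (n * m * (m - 1)) / 2) * (?e * ?e) \<in> I 2"
    by (intro cyc_ideal_mult_left cyc_ideal_mult_1_1 of_nat_half_in_cyc_ideal of_nat_in_cyc_ideal
        one_minus_qvar_power_in_cyc_ideal)
  then have 2: "of_nat t * (of_nat n * of_nat m * (of_nat m - 1) / 2) * (?e * ?e) \<in> I 2"
    using assms by (simp add: of_nat_diff)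
  have "qvar ^ (n * t) * G - (of_nat m - 3 * of_nat n * of_nat m * (of_nat m - 1) / 2 * ?e)
     = (qvar ^ (n * t) * G - (1 - of_nat t * ?e) * (of_nat m - of_nat n * of_nat m * (of_nat m - 1) / 2 * ?e))
       + of_nat t * (of_nat n * of_nat m * (of_nat m - 1) / 2) * (?e * ?e)"
    unfolding tm by (simp add: field_simps)
  then have "u * (qvar ^ (n * t) * G - (of_nat m - 3 * of_nat n * of_nat m * (of_nat m - 1) / 2 * ?e)) \<in> I 2"
    by (simp only:) (intro cyc_ideal_mult_left u0 cyc_ideal_add 1 2)
  then show ?thesis
    unfolding eq[unfolded G_def] u_def[symmetric] by (simp only: right_diff_distrib G_def)
qed

text \<open>Terms with k > n vanish because the lower index n - k is negative. The ends k = 0 and k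
  = n are separated, and the rest is indexed by j = n - k.\<close>

lemma tau0_split:
  assumes "m > 0"
  shows "tau0 (m * n) ((int m - 1) * int n) qvar = gbin qvar (int (2 * m * n)) n
    + (\<Sum>j\<in>{1..<n}. (-1) ^ (n - j) * qvar powi (int (m * n) * int (n - j) - int ((n - j) choose 2))
      * gbin qvar (int (m * n)) (n - j) * gbin qvar (2 * int (m * n) - 2 * int (n - j)) j)
    + (-1) ^ n * qvar powi (int (m * n) * int n - int (n choose 2)) * gbin qvar (int (m * n)) n"
proof -
  define T where "T = (\<lambda>k. (-1) ^ k * qvar powi (int (m * n) * int k - int (k choose 2))
    * gbin qvar (int (m * n)) k * gbin qvar (2 * int (m * n) - 2 * int k) (n - k))"
  have nmn: "n \<le> m * n" using assms by simp
  have "tau0 (m * n) ((int m - 1) * int n) qvar = (\<Sum>k=0..m*n. if k \<le> n then T k else 0)"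
    unfolding tau0_def
  proof (rule sum.cong)
    fix k assume k: "k \<in> {0..m * n}"
    have e: "int (m * n) - (int m - 1) * int n - int k = int n - int k" by (simp add: algebra_simps)
    show "(-1) ^ k * qvar powi (int (m * n) * int k - int (k choose 2)) * qbinomial qvar (int (m * n)) (int k)
        * qbinomial qvar (2 * int (m * n) - 2 * int k) (int (m * n) - (int m - 1) * int n - int k)
      = (if k \<le> n then T k else 0)"
    proof (cases "k \<le> n")
      case True
      have e': "int n - int k = int (n - k)" using True by simp
      have pos: "0 \<le> 2 * int (m * n) - 2 * int k" using k by (simp flip: of_nat_mult)
      show ?thesis
        unfolding e e' qbinomial_eq_gbin[OF pos] qbinomial_eq_gbin[OF of_nat_0_le_iff] T_def using True by simp
    next
      case False
      then show ?thesis unfolding e by (simp add: qbinomial_def)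
    qed
  qed simp
  also have "\<dots> = sum T {0..n}"
    using nmn by (intro sum.mono_neutral_cong_right) auto
  also have "{0..n} = insert 0 (insert n {1..<n})" using n_pos by auto
  also have "sum T \<dots> = T 0 + sum T {1..<n} + T n"
    using n_pos by simp
  also have "sum T {1..<n} = (\<Sum>j\<in>{1..<n}. T (n - j))"
    by (rule sum.reindex_bij_witness[of _ "\<lambda>j. n - j" "\<lambda>j. n - j"]) auto
  also have "\<dots> = (\<Sum>j\<in>{1..<n}. (-1) ^ (n - j) * qvar powi (int (m * n) * int (n - j) - int ((n - j) choose 2))
      * gbin qvar (int (m * n)) (n - j) * gbin qvar (2 * int (m * n) - 2 * int (n - j)) j)"
    unfolding T_def by (intro sum.cong) auto
  finally show ?thesis
    unfolding T_def by (simp add: binomial_eq_0 mult.assoc)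
qed

end

section \<open>Assembly of the congruence\<close>

theorem theorem1p1:
  fixes m n :: nat
  assumes "m > 0" and "n > 0"
  shows "rf_cong
    (tau0 (m * n) ((int m - 1) * int n) qvar)
    (2 * of_nat m - of_nat n * of_nat m * (2 * of_nat m - 1) * (1 - qvar ^ n)
      + (-1) ^ n * qvar ^ (n * (n + 1) div 2)
        * (of_nat m * (calA n qvar + calB n qvar - 1)
           - 3 * of_nat n * of_nat m * (of_nat m - 1) / 2 * (1 - qvar ^ n)))
    (cyclotomic n ^ 2)"
proof (rule rf_cong_if_cyc_ideal)
  note n = assms(2)
  let ?e = "1 - qvar ^ n"
  define u where "u = (-1) ^ n * qvar ^ (n * (n + 1) div 2)"
  define K where "K = calA n qvar + calB n qvar - 2"
  define F where "F = gbin qvar (int (2 * m * n)) n"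
  define L where "L = (-1) ^ n * qvar powi (int (m * n) * int n - int (n choose 2)) * gbin qvar (int (m * n)) n"
  define M where "M = (\<Sum>j\<in>{1..<n}. (-1) ^ (n - j) * qvar powi (int (m * n) * int (n - j) - int ((n - j) choose 2))
      * gbin qvar (int (m * n)) (n - j) * gbin qvar (2 * int (m * n) - 2 * int (n - j)) j)"
  define d :: "int poly fract" where "d = 3 * of_nat n * of_nat m * (of_nat m - 1) / 2 * ?e"
  have K: "K = (\<Sum>j\<in>{1..<n}. ?e * calterm n j)"
    unfolding K_def by (rule calA_plus_calB_calterm[OF n])
  \<comment> \<open>The Babbage congruence with 2m in place of m.\<close>
  have 1: "F - (2 * of_nat m - of_nat n * of_nat m * (2 * of_nat m - 1) * ?e) \<in> cyc_ideal n 2"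
    using gbin_mult_cong[OF n, of "2 * m"] assms(1) unfolding F_def by (simp add: mult.assoc)
  have 2: "L - u * (of_nat m - d) \<in> cyc_ideal n 2"
    unfolding L_def u_def d_def by (rule tau0_last_term_cong[OF n assms(1)])
  have 3: "M + of_nat m * K \<in> cyc_ideal n 2"
    unfolding M_def K sum_distrib_left sum.distrib[symmetric]
    by (intro cyc_ideal_sum tau0_middle_term_cong n)
  \<comment> \<open>Both K and 1 + u vanish to first order, so -mK may be replaced by umK; this
    brings the middle terms under the common factor u.\<close>
  have "K \<in> cyc_ideal n 1"
    unfolding K by (intro cyc_ideal_sum cyc_ideal_mult_right one_minus_qvar_power_in_cyc_ideal
      calterm_in_cyc_ideal n)
  then have 4: "of_nat m * ((1 + u) * K) \<in> cyc_ideal n 2"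
    unfolding u_def by (intro cyc_ideal_mult_left of_nat_in_cyc_ideal cyc_ideal_mult_1_1
      triangular_power_cong n)
  have K': "calA n qvar + calB n qvar - 1 = K + 1" by (simp add: K_def)
  have "F + M + L - (2 * of_nat m - of_nat n * of_nat m * (2 * of_nat m - 1) * ?e
        + u * (of_nat m * (K + 1) - d))
    = (F - (2 * of_nat m - of_nat n * of_nat m * (2 * of_nat m - 1) * ?e))
      + (L - u * (of_nat m - d)) + (M + of_nat m * K) - of_nat m * ((1 + u) * K)"
    by (simp add: algebra_simps)
  then show "tau0 (m * n) ((int m - 1) * int n) qvar
    - (2 * of_nat m - of_nat n * of_nat m * (2 * of_nat m - 1) * (1 - qvar ^ n)
      + (-1) ^ n * qvar ^ (n * (n + 1) div 2)
        * (of_nat m * (calA n qvar + calB n qvar - 1)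
           - 3 * of_nat n * of_nat m * (of_nat m - 1) / 2 * (1 - qvar ^ n))) \<in> cyc_ideal n 2"
    unfolding tau0_split[OF n assms(1)] K' u_def[symmetric] F_def[symmetric] L_def[symmetric]
      M_def[symmetric] d_def[symmetric]
    by (simp only:) (intro cyc_ideal_add cyc_ideal_diff 1 2 3 4 n)
qed

end
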